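(* Let $F \subset T$ be a $G_\delta$ subset of $T$ of Lebesgue (arc-length) measure zero. Then there exists $f \in H^\infty$ such that $\operatorname{Re} f(z) > 0$ for all $z \in \Delta$ (in particular $f$ has no zeros in $\Delta$), every point of $T$ is a Fatou point of $f$, and the radial limit $f(\zeta)$ equals $0$ if and only if $\zeta \in F$.
   Context: $\Delta = \{z \in \mathbb{C} : |z|<1\}$ is the open unit disc and $T = \{|z|=1\}$ is the unit circle. $H^\infty$ denotes the space of bounded analytic functions on $\Delta$. For $f \in H^\infty$ and $\zeta \in T$, the radial limit of $f$ at $\zeta$ is $f(\zeta) := \lim_{r \to 1^-} f(r\zeta)$ when this limit exists (as a finite complex number); $\zeta$ is called a Fatou point of $f$ if this radial limit exists. A $G_\delta$ subset of $T$ is a countable intersection of relatively open subsets of $T$. *)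

theory Defs
  imports "HOL-Analysis.Analysis"
begin

definition H_infty :: "(complex \<Rightarrow> complex) set" where
  "H_infty = {f. f holomorphic_on ball 0 1 \<and> bounded (f ` ball 0 1)}"

definition has_radial_limit :: "(complex \<Rightarrow> complex) \<Rightarrow> complex \<Rightarrow> complex \<Rightarrow> bool" where
  "has_radial_limit f \<zeta> L \<longleftrightarrow> ((\<lambda>r::real. f (complex_of_real r * \<zeta>)) \<longlongrightarrow> L) (at_left 1)"

definition fatou_point :: "(complex \<Rightarrow> complex) \<Rightarrow> complex \<Rightarrow> bool" where
  "fatou_point f \<zeta> \<longleftrightarrow> (\<exists>L. has_radial_limit f \<zeta> L)"

definition circle_null :: "complex set \<Rightarrow> bool" where
  "circle_null F \<longleftrightarrow> {t \<in> {0..2*pi}. cis t \<in> F} \<in> null_sets lborel"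

end

theory Submission
  imports Defs "HOL-Complex_Analysis.Complex_Analysis"
begin

text \<open>
  Write \<open>F\<close> as the decreasing intersection of relatively open sets with complements \<open>K n\<close>. For each \<open>n\<close>
  we find \<open>\<Phi> n\<close>, bounded by 1 with nonnegative real part and with radial limits everywhere, which is at
  most \<open>2\<^sup>-\<^sup>n\<close> on all radii ending in \<open>K n\<close> and whose radial limits on \<open>F\<close> have real part at least \<open>1/6\<close>.
  For \<open>h = (\<Sum>n. \<Phi> n)\<close> the function \<open>f = 1 / (1 + h)\<close> has the required properties: off \<open>F\<close> the
  series converges uniformly on the radius, and on \<open>F\<close> the real part of \<open>h\<close> tends to infinity.

  The function \<open>\<Phi> n\<close> is \<open>H / (1 + H)\<close> with \<open>H = (\<Sum>i. g i)\<close>, where \<open>F\<close> is covered by finite batches of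
  discs of rapidly decreasing total radius and \<open>g i\<close> is continuous on the closed disc, has real part at
  least \<open>1/5\<close> on the part of the circle covered by the \<open>i\<close>-th batch, and satisfies \<open>|g i| \<le> 20 Re (g i \<zeta>) + small\<close>
  on the whole radius ending at \<open>\<zeta>\<close>. This domination gives a dichotomy at every \<open>\<zeta>\<close>: either
  \<open>\<Sum>i. Re (g i \<zeta>)\<close> converges, and then \<open>H\<close> has a finite radial limit by the M-test, or it diverges,
  and then \<open>Re H\<close> tends to infinity, so that \<open>\<Phi> n\<close> has the radial limit 1.

  To obtain \<open>g i\<close>, start with the square root of a sum of kernels \<open>\<delta> / (1 + \<delta> - z cnj c)\<close>. Its values lie in
  a sector, so the Hardy--Littlewood maximal theorem for its real part shows that the set where its
  radial maximal function is not small is covered by discs of small total radius. Adding half of a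
  function that is large on that set, and iterating, yields the domination.
\<close>

subsection \<open>Kernels with values in a sector\<close>

definition arcs :: "(complex \<times> real) set \<Rightarrow> bool" where
  "arcs P \<longleftrightarrow> finite P \<and> (\<forall>p\<in>P. norm (fst p) = 1 \<and> 0 < snd p)"

text \<open>For \<open>norm c = 1\<close> the pole lies at \<open>(1 + d) * c\<close>, just outside
  the closed disc. On that disc the kernel is comparable to 1 within distance \<open>d\<close> of
  \<open>c\<close> and decays like \<open>d / norm (z - c)\<close> farther away.\<close>

definition bump :: "complex \<Rightarrow> real \<Rightarrow> complex \<Rightarrow> complex" where
  "bump c d z = of_real d / (1 + of_real d - z * cnj c)"

lemma norm_one_minus_mult_cnj: "norm c = 1 \<Longrightarrow> norm (1 - z * cnj c) = norm (z - c)"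
proof -
  assume c: "norm c = 1"
  hence "c * cnj c = 1" by (simp add: complex_norm_square[symmetric])
  hence "1 - z * cnj c = (c - z) * cnj c" by (simp add: algebra_simps)
  thus ?thesis using c by (simp add: norm_mult norm_minus_commute)
qed

lemma Re_one_minus_mult_cnj_nonneg: "norm c = 1 \<Longrightarrow> norm z \<le> 1 \<Longrightarrow> 0 \<le> Re (1 - z * cnj c)"
  using complex_Re_le_cmod[of "z * cnj c"] by (simp add: norm_mult)

text \<open>With \<open>x = 1 - z * cnj c\<close> the kernel is \<open>d / (x + d)\<close>, where
  \<open>Re x\<close> is nonnegative and \<open>norm x = norm (z - c)\<close>. Adding
  \<open>d\<close> cannot decrease the modulus of \<open>x\<close>, whence the decay; close to
  \<open>c\<close> the denominator has modulus at most \<open>2 * d\<close>, whence the 1/4.\<close>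

lemma
  assumes c: "norm c = 1" and d: "0 < d" and z: "norm z \<le> 1"
  shows bump_denom: "1 + complex_of_real d - z * cnj c \<noteq> 0"
    and Re_bump_pos: "0 < Re (bump c d z)"
    and norm_bump_le: "norm (bump c d z) * norm (z - c) \<le> d"
    and Re_bump_ge: "norm (z - c) \<le> d \<Longrightarrow> 1/4 \<le> Re (bump c d z)"
proof -
  define x where "x = 1 - z * cnj c"
  have x: "Re x \<ge> 0" "norm x = norm (z - c)"
    unfolding x_def using norm_one_minus_mult_cnj Re_one_minus_mult_cnj_nonneg c z by auto
  have eq: "1 + complex_of_real d - z * cnj c = x + of_real d" by (simp add: x_def)
  have re: "Re (x + of_real d) > 0" using x d by simp
  thus nz: "1 + complex_of_real d - z * cnj c \<noteq> 0" unfolding eq by force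
  have b: "bump c d z = of_real d / (x + of_real d)" by (simp add: bump_def eq)
  have reb: "Re (bump c d z) = d * (Re x + d) / (norm (x + of_real d))\<^sup>2"
    unfolding b by (simp add: Re_divide cmod_power2)
  have n0: "norm (x + of_real d) > 0" using nz eq by simp
  show "0 < Re (bump c d z)" unfolding reb using n0 x d by (intro divide_pos_pos mult_pos_pos) auto
  have "(norm (x + of_real d))\<^sup>2 = (norm x)\<^sup>2 + 2 * d * Re x + d\<^sup>2"
    unfolding cmod_power2 by (simp add: power2_eq_square algebra_simps)
  hence "(norm x)\<^sup>2 \<le> (norm (x + of_real d))\<^sup>2" using x d by simp
  hence le: "norm x \<le> norm (x + of_real d)" by (simp add: abs_le_square_iff[symmetric])
  have "norm (bump c d z) * norm (x + of_real d) = d" unfolding b using d n0 by (simp add: norm_divide)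
  thus "norm (bump c d z) * norm (z - c) \<le> d"
    using mult_left_mono[OF le, of "norm (bump c d z)"] x by simp
  assume zc: "norm (z - c) \<le> d"
  have "norm (x + of_real d) \<le> 2 * d" using norm_triangle_ineq[of x "of_real d"] zc x d by simp
  hence "(norm (x + of_real d))\<^sup>2 \<le> (2 * d)\<^sup>2" by (intro power_mono) auto
  also have "\<dots> = 4 * d * d" by (simp add: power2_eq_square)
  also have "\<dots> \<le> 4 * d * (Re x + d)" using x d by simp
  finally show "1/4 \<le> Re (bump c d z)" unfolding reb using n0 by (simp add: field_simps)
qed

text \<open>The principal root has argument of modulus below pi/4, so its imaginary part is smaller
  in modulus than its real part.\<close>

lemma norm_le_2_Re_csqrt:
  assumes "0 < Re z"
  shows "0 < Re (csqrt z)" "norm (csqrt z) \<le> 2 * Re (csqrt z)"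
proof -
  define w where "w = csqrt z"
  have "w\<^sup>2 = z" by (simp add: w_def)
  hence "Re (w\<^sup>2) > 0" using assms by simp
  hence "(Im w)\<^sup>2 < (Re w)\<^sup>2" by (simp add: power2_eq_square)
  hence "\<bar>Im w\<bar> < \<bar>Re w\<bar>" using real_sqrt_less_mono by fastforce
  moreover have "Re w \<ge> 0" unfolding w_def by (rule Re_csqrt)
  ultimately have "0 < Re w" "norm w \<le> 2 * Re w"
    using cmod_le[of w] by linarith+
  thus "0 < Re (csqrt z)" "norm (csqrt z) \<le> 2 * Re (csqrt z)"
    unfolding w_def .
qed

text \<open>The witness is the root of the sum of the bumps; the root confines the values to a
  sector, at the price of a square root in the decay. One bump with real part at least 1/4 gives the
  root modulus at least 1/2, and the sector turns this into real part at least 1/4.\<close>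

lemma sectorial_bump:
  assumes P: "arcs P" "P \<noteq> {}"
  shows "\<exists>w. w holomorphic_on ball 0 1 \<and> continuous_on (cball 0 1) w \<and>
    (\<forall>z\<in>cball 0 1. 0 < Re (w z) \<and> norm (w z) \<le> 2 * Re (w z) \<and>
       (\<forall>p\<in>P. norm (z - fst p) \<le> snd p \<longrightarrow> 1/4 \<le> Re (w z)) \<and>
       (\<forall>d>0. (\<forall>p\<in>P. d \<le> norm (z - fst p)) \<longrightarrow> norm (w z) \<le> sqrt (sum snd P / d)))"
proof -
  define H where "H z = (\<Sum>p\<in>P. bump (fst p) (snd p) z)" for z
  have fin: "finite P" and p: "\<And>p. p \<in> P \<Longrightarrow> norm (fst p) = 1" "\<And>p. p \<in> P \<Longrightarrow> 0 < snd p"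
    using P unfolding arcs_def by auto
  have pos: "0 < Re (H z)" if "norm z \<le> 1" for z
    unfolding H_def using P(2) fin p that by (auto intro!: sum_pos Re_bump_pos)
  have pos': "H z \<notin> \<real>\<^sub>\<le>\<^sub>0" if "norm z \<le> 1" for z
    using pos[OF that] by (auto simp: complex_nonpos_Reals_iff)
  have hol: "H holomorphic_on cball 0 1"
    unfolding H_def bump_def
    by (intro holomorphic_intros) (use p bump_denom in auto)
  show ?thesis
  proof (intro exI[of _ "\<lambda>z. csqrt (H z)"] conjI ballI allI impI)
    have "(\<lambda>z. csqrt (H z)) holomorphic_on cball 0 1"
      using hol pos' by (intro holomorphic_intros) auto
    thus "(\<lambda>z. csqrt (H z)) holomorphic_on ball 0 1" "continuous_on (cball 0 1) (\<lambda>z. csqrt (H z))"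
      by (auto intro: holomorphic_on_subset holomorphic_on_imp_continuous_on)
  next
    fix z :: complex assume "z \<in> cball 0 1"
    hence z: "norm z \<le> 1" by simp
    show "0 < Re (csqrt (H z))" "norm (csqrt (H z)) \<le> 2 * Re (csqrt (H z))"
      using norm_le_2_Re_csqrt[OF pos[OF z]] by auto
    {
      fix q assume q: "q \<in> P" "norm (z - fst q) \<le> snd q"
      have "1/4 \<le> Re (bump (fst q) (snd q) z)" using Re_bump_ge p q z by blast
      also have "\<dots> \<le> (\<Sum>p\<in>P. Re (bump (fst p) (snd p) z))"
        using fin q p z by (intro member_le_sum) (auto intro: less_imp_le[OF Re_bump_pos])
      also have "\<dots> \<le> norm (H z)" using complex_Re_le_cmod[of "H z"] by (simp add: H_def)
      finally have "sqrt (1/4) \<le> norm (csqrt (H z))" by (simp del: real_sqrt_divide)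
      moreover have "sqrt (1/4 :: real) = 1/2" by (simp add: real_sqrt_divide)
      ultimately show "1/4 \<le> Re (csqrt (H z))" using norm_le_2_Re_csqrt[OF pos[OF z]] by simp
    }
    {
      fix d :: real assume d: "0 < d" and far: "\<forall>p\<in>P. d \<le> norm (z - fst p)"
      have "norm (H z) \<le> (\<Sum>p\<in>P. norm (bump (fst p) (snd p) z))" unfolding H_def by (rule norm_sum)
      also have "\<dots> \<le> (\<Sum>p\<in>P. snd p / d)"
      proof (rule sum_mono)
        fix q assume q: "q \<in> P"
        have "norm (bump (fst q) (snd q) z) * d \<le> norm (bump (fst q) (snd q) z) * norm (z - fst q)"
          using far q by (intro mult_left_mono) auto
        also have "\<dots> \<le> snd q" using norm_bump_le p q z by blast
        finally show "norm (bump (fst q) (snd q) z) \<le> snd q / d" using d by (simp add: field_simps)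
      qed
      also have "\<dots> = sum snd P / d" by (simp add: sum_divide_distrib)
      finally show "norm (csqrt (H z)) \<le> sqrt (sum snd P / d)" by (simp del: real_sqrt_divide)
    }
  qed
qed

lemma Re_inverse_one_plus_le:
  assumes "0 \<le> Re w" shows "Re (1 / (1 + w)) \<le> 1 / (1 + Re w)"
proof -
  have "Re (1 / (1 + w)) \<le> norm (1 / (1 + w))" by (rule complex_Re_le_cmod)
  also have "\<dots> = 1 / norm (1 + w)" by (simp add: norm_divide)
  also have "\<dots> \<le> 1 / (1 + Re w)"
    using assms complex_Re_le_cmod[of "1 + w"] by (intro divide_left_mono mult_pos_pos) auto
  finally show ?thesis .
qed

text \<open>The map \<open>w / (1 + w)\<close> takes the closed right half-plane into the closed
  disc with diameter from 0 to 1 and sends infinity to 1. It makes functions bounded without losing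
  the sign of their real part.\<close>

lemma cayley_half_plane:
  assumes "0 \<le> Re w"
  shows "1 + w \<noteq> 0" "norm (w / (1 + w)) \<le> 1" "norm (w / (1 + w)) \<le> norm w"
    "Re w / (1 + Re w) \<le> Re (w / (1 + w))" "0 \<le> Re (w / (1 + w))"
proof -
  have re: "1 \<le> Re (1 + w)" using assms by simp
  thus nz: "1 + w \<noteq> 0" by force
  have n1: "1 \<le> norm (1 + w)" using re complex_Re_le_cmod[of "1 + w"] by linarith
  have "(norm w)\<^sup>2 \<le> (norm (1 + w))\<^sup>2" using assms unfolding cmod_power2 by (simp add: power2_eq_square algebra_simps)
  hence "norm w \<le> norm (1 + w)" by (simp add: abs_le_square_iff[symmetric])
  thus "norm (w / (1 + w)) \<le> 1" using n1 by (simp add: norm_divide divide_le_eq)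
  show "norm (w / (1 + w)) \<le> norm w"
    using n1 mult_left_mono[OF n1 norm_ge_zero[of w]] by (simp add: norm_divide divide_le_eq)
  have "w / (1 + w) = 1 - 1 / (1 + w)" using nz by (simp add: field_simps)
  hence "Re (w / (1 + w)) \<ge> 1 - 1 / (1 + Re w)" using Re_inverse_one_plus_le[OF assms] by simp
  also have "1 - 1 / (1 + Re w) = Re w / (1 + Re w)" using assms by (simp add: field_simps)
  finally show *: "Re w / (1 + Re w) \<le> Re (w / (1 + w))" .
  show "0 \<le> Re (w / (1 + w))" using * assms by (smt (verit) divide_nonneg_nonneg)
qed

subsection \<open>The Poisson integral and the radial maximal function\<close>

text \<open>Up to pi/3 the difference \<open>sin y - y / 2\<close> increases, since the cosine is at
  least 1/2; beyond, the sine exceeds 0.85 while \<open>x / 2\<close> is at most pi/4.\<close>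

lemma half_le_sin:
  assumes "0 \<le> x" "x \<le> pi / 2" shows "x / 2 \<le> sin x"
proof (cases "x \<le> pi / 3")
  case True
  have "(\<lambda>y. sin y - y / 2) 0 \<le> (\<lambda>y. sin y - y / 2) x"
  proof (rule DERIV_nonneg_imp_nondecreasing[OF assms(1)])
    fix y assume y: "0 \<le> y" "y \<le> x"
    have "cos (pi/3) \<le> cos y" using y True by (intro cos_monotone_0_pi_le) auto
    hence "0 \<le> cos y - 1/2" by (simp add: cos_60)
    moreover have "((\<lambda>y. sin y - y / 2) has_real_derivative cos y - 1/2) (at y)"
      by (auto intro!: derivative_eq_intros)
    ultimately show "\<exists>m. ((\<lambda>y. sin y - y / 2) has_real_derivative m) (at y) \<and> 0 \<le> m" by blast
  qed
  thus ?thesis by simp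
next
  case False
  have "17/10 \<le> sqrt 3" by (rule real_le_rsqrt) (simp add: power2_eq_square)
  moreover have "sin (pi/3) \<le> sin x" using False assms by (intro sin_monotone_2pi_le) auto
  ultimately have "17/20 \<le> sin x" by (simp add: sin_60)
  moreover have "pi < 32/10" using pi_approx by simp
  ultimately show ?thesis using assms by linarith
qed

lemma norm_cis_minus_1: "norm (cis t - 1) = 2 * \<bar>sin (t/2)\<bar>"
proof -
  have "(norm (cis t - 1))\<^sup>2 = (cos t - 1)\<^sup>2 + (sin t)\<^sup>2" by (simp add: cmod_power2)
  also have "\<dots> = 2 - 2 * cos t" using sin_cos_squared_add[of t] by (simp add: power2_eq_square algebra_simps)
  also have "\<dots> = (2 * \<bar>sin (t/2)\<bar>)\<^sup>2"
    using cos_double_sin[of "t/2"] by (simp add: power_mult_distrib)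
  finally show ?thesis by (metis abs_ge_zero mult_nonneg_nonneg norm_ge_zero power2_eq_iff_nonneg zero_le_numeral)
qed

text \<open>The chord from \<open>cis t\<close> to 1 is at least \<open>\<bar>t\<bar> / 2\<close>.
  Moving its end from 1 to \<open>r\<close> costs \<open>1 - r\<close>, itself at most the distance
  from \<open>cis t\<close> to \<open>r\<close>; hence one more factor 2. This bounds the Poisson
  kernel away from its peak.\<close>

lemma norm_cis_diff_ge:
  assumes "\<bar>t\<bar> \<le> pi" "0 \<le> r" "r \<le> 1" shows "\<bar>t\<bar> / 4 \<le> norm (cis t - of_real r)"
proof -
  have "sin (\<bar>t\<bar>/2) \<le> \<bar>sin (t/2)\<bar>" by (cases "0 \<le> t") auto
  hence "2 * sin (\<bar>t\<bar>/2) \<le> norm (cis t - 1)" by (simp add: norm_cis_minus_1)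
  moreover have "\<bar>t\<bar>/2/2 \<le> sin (\<bar>t\<bar>/2)" using assms by (intro half_le_sin) auto
  ultimately have 1: "\<bar>t\<bar> / 2 \<le> norm (cis t - 1)" by simp
  have "norm (cis t - 1) \<le> norm (cis t - of_real r) + norm (of_real r - 1 :: complex)"
    using norm_triangle_ineq[of "cis t - of_real r" "of_real r - 1"] by simp
  also have "norm (of_real r - 1 :: complex) = 1 - r"
    using norm_of_real[of "r - 1", where 'a = complex] assms by simp
  also have "1 - r \<le> norm (cis t - of_real r)"
    using norm_triangle_ineq2[of "cis t" "of_real r"] assms by simp
  finally show ?thesis using 1 by simp
qed

lemma norm_cis_diff_le: "norm (cis s - cis t) \<le> \<bar>s - t\<bar>"
proof -
  have *: "norm (cis u - 1) \<le> \<bar>u\<bar>" for u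
    using abs_sin_x_le_abs_x[of "u/2"] by (simp add: norm_cis_minus_1)
  have "cis s - cis t = cis t * (cis (s - t) - 1)" by (simp add: algebra_simps cis_mult)
  thus ?thesis using *[of "s - t"] by (simp add: norm_mult)
qed

text \<open>Cauchy's formula is applied not to \<open>w\<close> but to \<open>F\<close>, which
  agrees with \<open>w\<close> at \<open>z\<close>. On the circle
  \<open>1 - cnj z * u = u * cnj (u - z)\<close>, so the extra factor turns the Cauchy kernel into
  the Poisson kernel.\<close>

lemma poisson_at_origin_angle:
  assumes w: "w holomorphic_on ball 0 1" "continuous_on (cball 0 1) w" and z: "norm z < 1"
  shows "((\<lambda>t. w (cis t) * of_real ((1 - (norm z)\<^sup>2) / (norm (cis t - z))\<^sup>2)) has_integral
           2 * of_real pi * w z) {0..2*pi}"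
proof -
  have ii: "(- \<i>) * (y * \<i> * c) = y * c" for y c :: complex
  proof -
    have "(- \<i>) * (y * \<i> * c) = (- \<i> * \<i>) * (y * c)" by (simp only: mult_ac)
    thus ?thesis by simp
  qed
  define F where "F u = w u * of_real (1 - (norm z)\<^sup>2) / (1 - cnj z * u)" for u
  have nz: "1 - cnj z * u \<noteq> 0" if "norm u \<le> 1" for u
  proof
    assume "1 - cnj z * u = 0"
    hence "cnj z * u = 1" by simp
    hence "norm (cnj z * u) = 1" by simp
    moreover have "norm (cnj z * u) \<le> norm z * 1" unfolding norm_mult using that by (intro mult_mono) auto
    ultimately show False using z by simp
  qed
  have "F holomorphic_on ball 0 1" unfolding F_def using nz by (intro holomorphic_intros w) auto
  moreover have "continuous_on (cball 0 1) F" unfolding F_def using nz by (intro continuous_intros w) auto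
  ultimately have "((\<lambda>u. F u / (u - z)) has_contour_integral (2 * of_real pi * \<i> * F z)) (circlepath 0 1)"
    using z by (intro Cauchy_integral_circlepath) auto
  hence "((\<lambda>t. F (cis t) / (cis t - z) * \<i> * cis t) has_integral 2 * of_real pi * \<i> * F z) {0..2*pi}"
    unfolding circlepath_def by (subst (asm) has_contour_integral_part_circlepath_iff) simp_all
  hence "((\<lambda>t. (- \<i>) * (F (cis t) / (cis t - z) * \<i> * cis t)) has_integral (- \<i>) * (2 * of_real pi * \<i> * F z)) {0..2*pi}"
    by (rule has_integral_mult_right)
  moreover have "(- \<i>) * (2 * of_real pi * \<i> * F z) = 2 * of_real pi * w z"
  proof -
    have "1 - cnj z * z = of_real (1 - (norm z)\<^sup>2)"
      by (simp only: of_real_diff of_real_1 complex_norm_square mult.commute)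
    moreover have "1 - cnj z * z \<noteq> 0" using nz[of z] z by simp
    ultimately have "F z = w z" by (simp add: F_def)
    thus ?thesis by (simp only: ii)
  qed
  moreover have "(- \<i>) * (F (cis t) / (cis t - z) * \<i> * cis t) =
      w (cis t) * of_real ((1 - (norm z)\<^sup>2) / (norm (cis t - z))\<^sup>2)" for t
  proof -
    have ne: "cis t - z \<noteq> 0" using z by auto
    have "(1 - cnj z * cis t) = cis t * cnj (cis t - z)"
      by (simp add: algebra_simps cis_cnj cis_mult)
    hence "(1 - cnj z * cis t) * (cis t - z) = cis t * of_real ((norm (cis t - z))\<^sup>2)"
      unfolding complex_norm_square by (simp only: mult_ac)
    hence "(1 - cnj z * cis t) * (cis t - z) / cis t = of_real ((norm (cis t - z))\<^sup>2)" by simp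
    moreover have "(- \<i>) * (F (cis t) / (cis t - z) * \<i> * cis t) =
       w (cis t) * of_real (1 - (norm z)\<^sup>2) / ((1 - cnj z * cis t) * (cis t - z) / cis t)"
      unfolding ii F_def by (simp add: mult_ac)
    ultimately show ?thesis by (simp add: of_real_divide)
  qed
  ultimately show ?thesis by (simp only:)
qed

lemma poisson_centred:
  assumes w: "w holomorphic_on ball 0 1" "continuous_on (cball 0 1) w" and r: "0 \<le> r" "r < 1"
  shows "((\<lambda>t. Re (w (cis t)) * ((1 - r\<^sup>2) / (norm (cis (t - s) - of_real r))\<^sup>2)) has_integral
           2 * pi * Re (w (of_real r * cis s))) {s-pi..s+pi}"
proof -
  \<comment> \<open>The minus sign moves the evaluation point to angle pi, the midpoint of
    \<open>{0..2*pi}\<close>, so that the shift by \<open>pi - s\<close> produces an interval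
    symmetric about \<open>s\<close>.\<close>
  define c where "c = - cis s"
  define W where "W u = w (c * u)" for u
  have c: "norm (c * u) = norm u" for u by (simp add: c_def norm_mult)
  have "W holomorphic_on ball 0 1" unfolding W_def
    by (rule holomorphic_on_compose_gen[of _ _ w, unfolded o_def, OF _ w(1)])
       (auto intro!: holomorphic_intros simp: c)
  moreover have "continuous_on (cball 0 1) W" unfolding W_def
    by (rule continuous_on_compose2[OF w(2)]) (auto intro!: continuous_intros simp: c)
  ultimately have "((\<lambda>t. W (cis t) * of_real ((1 - (norm (- of_real r :: complex))\<^sup>2) / (norm (cis t - (- of_real r)))\<^sup>2)) has_integral
           2 * of_real pi * W (- of_real r)) {0..2*pi}"
    using r by (intro poisson_at_origin_angle) auto
  hence "((\<lambda>t. Re (W (cis t) * of_real ((1 - r\<^sup>2) / (norm (cis t + of_real r))\<^sup>2))) has_integral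
           Re (2 * of_real pi * W (- of_real r))) {0..2*pi}"
    by (intro has_integral_Re) simp
  hence *: "((\<lambda>t. Re (W (cis t)) * ((1 - r\<^sup>2) / (norm (cis t + of_real r))\<^sup>2)) has_integral
           2 * pi * Re (W (- of_real r))) {0..2*pi}"
    by (simp del: of_real_divide of_real_power of_real_diff)
  have "((\<lambda>t. Re (W (cis (t + (pi - s)))) * ((1 - r\<^sup>2) / (norm (cis (t + (pi - s)) + of_real r))\<^sup>2)) has_integral
           2 * pi * Re (W (- of_real r))) {0 - (pi - s)..2*pi - (pi - s)}"
    by (rule has_integral_shift_real_ivl[OF *])
  moreover have A: "cis (t + (pi - s)) = - cis (t - s)" for t
    using cis_mult[of pi "t - s"] by (simp add: algebra_simps)
  have "W (cis (t + (pi - s))) = w (cis t)" for t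
    unfolding W_def c_def A by (simp add: cis_mult)
  moreover have "norm (cis (t + (pi - s)) + of_real r) = norm (cis (t - s) - of_real r)" for t
    unfolding A using norm_minus_commute[of "of_real r" "cis (t - s)"] by simp
  moreover have "W (- of_real r) = w (of_real r * cis s)" by (simp add: W_def c_def mult.commute)
  ultimately show ?thesis by (simp add: algebra_simps)
qed

text \<open>Doubling the radius adds two side intervals on which \<open>q \<le> c\<close>; since
  \<open>v\<close> is nonnegative, they contribute at most \<open>c\<close> times the integral of
  \<open>v\<close> over the whole larger interval.\<close>

lemma annulus_step:
  fixes q v :: "real \<Rightarrow> real"
  assumes cont: "continuous_on UNIV q" "continuous_on UNIV v"
    and v: "\<And>t. 0 \<le> v t" and q: "\<And>t. h \<le> \<bar>t - s\<bar> \<Longrightarrow> q t \<le> c" and c: "0 \<le> c" and h: "0 < h"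
  shows "integral {s-2*h..s+2*h} (\<lambda>t. q t * v t)
    \<le> integral {s-h..s+h} (\<lambda>t. q t * v t) + c * integral {s-2*h..s+2*h} v"
proof -
  have int: "(\<lambda>t. q t * v t) integrable_on {a..b}" "v integrable_on {a..b}"
      "(\<lambda>t. c * v t) integrable_on {a..b}" for a b
    by (auto intro!: integrable_continuous_real continuous_intros continuous_on_subset[OF cont(1)] continuous_on_subset[OF cont(2)])
  have split: "integral {s-2*h..s+2*h} f = integral {s-2*h..s-h} f + integral {s-h..s+h} f + integral {s+h..s+2*h} f"
    if "\<And>a b. f integrable_on {a..b}" for f :: "real \<Rightarrow> real"
  proof -
    have "integral {s-2*h..s+2*h} f = integral {s-2*h..s-h} f + integral {s-h..s+2*h} f"
      using h that by (intro Henstock_Kurzweil_Integration.integral_combine[symmetric]) auto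
    also have "integral {s-h..s+2*h} f = integral {s-h..s+h} f + integral {s+h..s+2*h} f"
      using h that by (intro Henstock_Kurzweil_Integration.integral_combine[symmetric]) auto
    finally show ?thesis by simp
  qed
  have out: "integral {a..b} (\<lambda>t. q t * v t) \<le> c * integral {a..b} v"
    if "\<And>t. t \<in> {a..b} \<Longrightarrow> h \<le> \<bar>t - s\<bar>" for a b
  proof -
    have "integral {a..b} (\<lambda>t. q t * v t) \<le> integral {a..b} (\<lambda>t. c * v t)"
      using that q v int by (intro integral_le mult_right_mono) auto
    thus ?thesis by simp
  qed
  have "0 \<le> c * integral {s-h..s+h} v" using c v int by (intro mult_nonneg_nonneg Henstock_Kurzweil_Integration.integral_nonneg) auto
  moreover have "integral {s-2*h..s-h} (\<lambda>t. q t * v t) \<le> c * integral {s-2*h..s-h} v"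
    by (rule out) (use h in auto)
  moreover have "integral {s+h..s+2*h} (\<lambda>t. q t * v t) \<le> c * integral {s+h..s+2*h} v"
    by (rule out) (use h in auto)
  ultimately show ?thesis using split[OF int(1)] split[OF int(2)] by (simp add: algebra_simps)
qed

text \<open>Pointwise bound of the Poisson integral by the Hardy-Littlewood maximal function, in
  contrapositive form. If all integrals over intervals centred at \<open>s\<close> are at most
  \<open>A * h\<close>, a dyadic decomposition bounds the Poisson integral by \<open>40 * A\<close>,
  which is below \<open>2 * pi * (7 * A)\<close>.\<close>

lemma large_mean_on_interval:
  assumes w: "w holomorphic_on ball 0 1" "continuous_on (cball 0 1) w"
    and pos: "\<And>z. z \<in> cball 0 1 \<Longrightarrow> 0 \<le> Re (w z)"
    and r: "0 \<le> r" "r < 1" and A: "0 < A" "7 * A < Re (w (of_real r * cis s))"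
  obtains h where "0 < h" "h < 2 * pi" "A * h < integral {s-h..s+h} (\<lambda>t. Re (w (cis t)))"
proof (rule ccontr)
  assume "\<not> thesis"
  with that have small: "integral {s-h..s+h} (\<lambda>t. Re (w (cis t))) \<le> A * h" if "0 < h" "h < 2 * pi" for h
    using that by (meson linorder_not_less)
  define v where "v t = Re (w (cis t))" for t
  define \<sigma> where "\<sigma> = 1 - r"
  have \<sigma>: "0 < \<sigma>" "\<sigma> \<le> 1" using r by (auto simp: \<sigma>_def)
  \<comment> \<open>A majorant of the Poisson kernel:
    \<open>1 - r\<^sup>2 \<le> 2 * \<sigma>\<close>, and the distance from
    \<open>cis (t - s)\<close> to \<open>r\<close> is at least both \<open>\<sigma>\<close> and
    \<open>\<bar>t - s\<bar> / 4\<close>.\<close>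
  define q where "q t = 2 * \<sigma> / (max \<sigma> (\<bar>t - s\<bar> / 4))\<^sup>2" for t
  define h where "h k = 4 * \<sigma> * 2 ^ k" for k :: nat
  define J where "J k = integral {s - h k..s + h k} (\<lambda>t. q t * v t)" for k
  have h0: "0 < h k" for k using \<sigma> by (simp add: h_def)
  have v0: "0 \<le> v t" for t unfolding v_def by (rule pos) simp
  have contv: "continuous_on UNIV v" unfolding v_def
    by (intro continuous_intros continuous_on_compose2[OF w(2)]) auto
  have contq: "continuous_on UNIV q" unfolding q_def
    using \<sigma> by (intro continuous_intros) (auto simp: max_def split: if_splits)
  have q0: "0 \<le> q t" for t using \<sigma> by (simp add: q_def)
  have int: "(\<lambda>t. q t * v t) integrable_on {a..b}" "v integrable_on {a..b}"
      "(\<lambda>t. c * v t) integrable_on {a..b}" for a b c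
    by (auto intro!: integrable_continuous_real continuous_intros continuous_on_subset[OF contq] continuous_on_subset[OF contv])
  have "\<exists>n. pi \<le> h n"
  proof -
    obtain n where "pi / (4 * \<sigma>) < 2 ^ n" using real_arch_pow[of 2 "pi / (4 * \<sigma>)"] by auto
    thus ?thesis using \<sigma> by (intro exI[of _ n]) (simp add: h_def field_simps)
  qed
  \<comment> \<open>Stopping at the first dyadic radius that reaches pi keeps every
    \<open>h k\<close> with \<open>k \<le> n\<close> below \<open>2 * pi\<close>, the range in which
    the integrals are controlled.\<close>
  define n where "n = (LEAST n. pi \<le> h n)"
  have n: "pi \<le> h n" unfolding n_def using \<open>\<exists>n. pi \<le> h n\<close> by (rule LeastI_ex)
  have hpi: "h k < 2 * pi" if "k \<le> n" for k
  proof (cases k)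
    case 0 thus ?thesis using \<sigma> pi_gt3 by (simp add: h_def)
  next
    case (Suc m)
    hence "\<not> pi \<le> h m" using that unfolding n_def by (intro not_less_Least) simp
    thus ?thesis using Suc by (simp add: h_def)
  qed
  have I: "integral {s - h k..s + h k} v \<le> A * h k" if "k \<le> n" for k
    using small[OF h0 hpi[OF that]] by (simp add: v_def[abs_def])
  \<comment> \<open>The core interval contributes \<open>8 * A\<close> and the \<open>k\<close>-th
    annulus \<open>16 * A / 2 ^ k\<close>; the bound is the partial sum of this geometric
    series.\<close>
  have "J k \<le> 8 * A + 32 * A * (1 - 1 / 2 ^ k)" if "k \<le> n" for k
    using that
  proof (induction k)
    case 0
    have "J 0 \<le> integral {s - h 0..s + h 0} (\<lambda>t. 2 / \<sigma> * v t)" unfolding J_def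
    proof (intro integral_le int mult_right_mono v0)
      fix t show "q t \<le> 2 / \<sigma>"
      proof -
        have "\<sigma>\<^sup>2 \<le> (max \<sigma> (\<bar>t - s\<bar> / 4))\<^sup>2" using \<sigma> by (intro power_mono) auto
        hence "q t \<le> 2 * \<sigma> / \<sigma>\<^sup>2" unfolding q_def using \<sigma> by (intro divide_left_mono) auto
        thus ?thesis using \<sigma> by (simp add: power2_eq_square)
      qed
    qed
    also have "\<dots> = 2 / \<sigma> * integral {s - h 0..s + h 0} v" by simp
    also have "\<dots> \<le> 2 / \<sigma> * (A * h 0)" using I[of 0] \<sigma> by (intro mult_left_mono) auto
    also have "\<dots> = 8 * A" using \<sigma> by (simp add: h_def)
    finally show ?case by simp
  next
    case (Suc k)
    define c where "c = 2 * \<sigma> / (h k / 4)\<^sup>2"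
    have hs: "h (Suc k) = 2 * h k" by (simp add: h_def)
    have "J (Suc k) \<le> J k + c * integral {s - h (Suc k)..s + h (Suc k)} v"
      unfolding J_def hs
    proof (rule annulus_step[OF contq contv v0 _ _ h0])
      show "0 \<le> c" using \<sigma> by (simp add: c_def)
      fix t assume t: "h k \<le> \<bar>t - s\<bar>"
      have "h k / 4 \<le> max \<sigma> (\<bar>t - s\<bar> / 4)" using t by (intro max.coboundedI2) simp
      hence "(h k / 4)\<^sup>2 \<le> (max \<sigma> (\<bar>t - s\<bar> / 4))\<^sup>2" using h0[of k] by (intro power_mono) auto
      thus "q t \<le> c" unfolding q_def c_def using \<sigma> h0[of k] 
        by (intro divide_left_mono mult_pos_pos zero_less_power) (auto simp: less_max_iff_disj)
    qed
    also have "c * integral {s - h (Suc k)..s + h (Suc k)} v \<le> c * (A * h (Suc k))"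
      using I[OF Suc.prems] \<sigma> by (intro mult_left_mono) (auto simp: c_def)
    also have "c * (A * h (Suc k)) = 16 * A / 2 ^ k"
      using \<sigma> by (simp add: c_def h_def power2_eq_square field_simps)
    finally show ?case using Suc by (simp add: field_simps)
  qed
  from this[of n] have "J n \<le> 8 * A + 32 * A * (1 - 1 / 2 ^ n)" by simp
  also have "\<dots> \<le> 40 * A" using A by (simp add: field_simps)
  finally have Jn: "J n \<le> 40 * A" .
  define p where "p t = (1 - r\<^sup>2) / (norm (cis (t - s) - of_real r))\<^sup>2" for t
  have P: "((\<lambda>t. v t * p t) has_integral 2 * pi * Re (w (of_real r * cis s))) {s-pi..s+pi}"
    unfolding v_def p_def by (rule poisson_centred[OF w r])
  have "2 * pi * Re (w (of_real r * cis s)) \<le> integral {s-pi..s+pi} (\<lambda>t. q t * v t)"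
  proof (rule has_integral_le[OF P integrable_integral[OF int(1)]])
    fix t assume t: "t \<in> {s-pi..s+pi}"
    have "\<sigma> \<le> norm (cis (t - s) - of_real r)"
      using norm_triangle_ineq2[of "cis (t - s)" "of_real r"] r by (simp add: \<sigma>_def)
    moreover have "\<bar>t - s\<bar> / 4 \<le> norm (cis (t - s) - of_real r)"
      using t r by (intro norm_cis_diff_ge) auto
    ultimately have "(max \<sigma> (\<bar>t - s\<bar> / 4))\<^sup>2 \<le> (norm (cis (t - s) - of_real r))\<^sup>2"
      using \<sigma> by (intro power_mono) auto
    moreover have "1 - r\<^sup>2 \<le> 2 * \<sigma>"
      using zero_le_power2[of "1 - r"] by (simp add: \<sigma>_def power2_eq_square algebra_simps)
    ultimately have "p t \<le> q t" unfolding p_def q_def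
      using \<sigma> r by (intro frac_le) (auto intro!: zero_less_power simp: less_max_iff_disj)
    thus "v t * p t \<le> q t * v t" using v0[of t] by (simp add: mult.commute mult_right_mono)
  qed
  also have "\<dots> \<le> J n" unfolding J_def
    using n q0 v0 by (intro integral_subset_le int) auto
  finally have "2 * pi * Re (w (of_real r * cis s)) \<le> 40 * A" using Jn by simp
  moreover have "6 * (7 * A) < 2 * pi * Re (w (of_real r * cis s))"
    using A pi_gt3 by (intro mult_strict_mono) auto
  ultimately show False using A by simp
qed

text \<open>Three periods contain every interval with centre in \<open>{0..2*pi}\<close> and radius
  below \<open>2 * pi\<close>, the intervals met in the covering argument; each period contributes
  the mean value at 0.\<close>

lemma integral_three_periods:
  assumes w: "w holomorphic_on ball 0 1" "continuous_on (cball 0 1) w"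
  shows "integral {-(2*pi)..4*pi} (\<lambda>t. Re (w (cis t))) = 6 * pi * Re (w 0)"
proof -
  have *: "((\<lambda>t. Re (w (cis t))) has_integral 2 * pi * Re (w 0)) {s-pi..s+pi}" for s
    using poisson_centred[OF w, of 0 s] by simp
  have "((\<lambda>t. Re (w (cis t))) has_integral (2 * pi * Re (w 0) + 2 * pi * Re (w 0))) {-(2*pi)..2*pi}"
    using *[of "-pi"] *[of pi] by (intro has_integral_combine[where c=0]) auto
  hence "((\<lambda>t. Re (w (cis t))) has_integral (2 * pi * Re (w 0) + 2 * pi * Re (w 0)) + 2 * pi * Re (w 0)) {-(2*pi)..4*pi}"
    by (rule has_integral_combine[where c="2*pi", rotated 2]) (use *[of "3 * pi"] in auto)
  thus ?thesis by (simp add: integral_unique)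
qed

text \<open>The sector condition lets the positive harmonic function \<open>Re w\<close> control \<open>|w|\<close>.\<close>

lemma weak_type_cover:
  assumes w: "w holomorphic_on ball 0 1" "continuous_on (cball 0 1) w"
    and sec: "\<And>z. z \<in> cball 0 1 \<Longrightarrow> norm (w z) \<le> 2 * Re (w z)"
    and E: "compact E" "E \<subseteq> sphere 0 1" and \<theta>: "0 < \<theta>"
    and large: "\<And>\<zeta>. \<zeta> \<in> E \<Longrightarrow> \<exists>r\<in>{0..1}. \<theta> \<le> norm (w (of_real r * \<zeta>))"
  obtains P where "arcs P" "fst ` P \<subseteq> E" "E \<subseteq> (\<Union>p\<in>P. ball (fst p) (snd p))"
    "sum snd P \<le> 3024 * norm (w 0) / \<theta>"
proof -
  define v where "v t = Re (w (cis t))" for t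
  have pos: "0 \<le> Re (w z)" if "z \<in> cball 0 1" for z
    using sec[OF that] norm_ge_zero[of "w z"] by linarith
  define K where "K = {s \<in> {0..2*pi}. cis s \<in> E}"
  have "\<exists>h. 0 < h \<and> h < 2 * pi \<and> \<theta> / 21 * h < integral {s-h..s+h} v" if s: "s \<in> K" for s
  proof -
    obtain r where r: "r \<in> {0..1}" "\<theta> \<le> norm (w (of_real r * cis s))" using large[of "cis s"] s by (auto simp: K_def)
    have "of_real r * cis s \<in> cball 0 1" using r by (simp add: norm_mult)
    hence "\<theta> / 3 < Re (w (of_real r * cis s))" using sec[of "of_real r * cis s"] r \<theta> by simp
    moreover have "((\<lambda>r. Re (w (of_real r * cis s))) \<longlongrightarrow> Re (w (of_real r * cis s))) (at r within {0..1})"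
    proof -
      have "continuous_on {0..1} (\<lambda>r. Re (w (of_real r * cis s)))"
        by (intro continuous_intros continuous_on_compose2[OF w(2)]) (auto simp: norm_mult)
      thus ?thesis using r by (simp add: continuous_on_def)
    qed
    ultimately have ev: "\<forall>\<^sub>F r' in at r within {0..1}. \<theta> / 3 < Re (w (of_real r' * cis s))"
      by (rule order_tendstoD(1)[rotated])
    \<comment> \<open>The large value may be attained at \<open>r = 1\<close>, outside the reach of
      the Poisson formula. Continuity moves it inside; lowering the threshold from
      \<open>\<theta> / 2\<close> to \<open>\<theta> / 3\<close> leaves room for that.\<close>
    have "\<exists>r'\<in>{0..<1}. \<theta> / 3 < Re (w (of_real r' * cis s))"
    proof (cases "r = 1")
      case True
      have "at 1 within {0..1} = at_left (1::real)"
        by (rule at_within_Icc_at_left) simp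
      with ev True have "\<forall>\<^sub>F r' in at_left 1. \<theta> / 3 < Re (w (of_real r' * cis s))"
        by (simp only:)
      moreover have "\<forall>\<^sub>F r' in at_left 1. r' \<in> {0<..<1::real}"
        by (rule eventually_at_left_real) simp
      ultimately have "\<forall>\<^sub>F r' in at_left 1. r' \<in> {0..<1} \<and> \<theta> / 3 < Re (w (of_real r' * cis s))"
        by eventually_elim auto
      from eventually_happens[OF this] show ?thesis by auto
    next
      case False
      thus ?thesis using r \<open>\<theta> / 3 < _\<close> by (intro bexI[of _ r]) auto
    qed
    then obtain r' where r': "0 \<le> r'" "r' < 1" "7 * (\<theta> / 21) < Re (w (of_real r' * cis s))" by auto
    have "0 < \<theta> / 21" using \<theta> by simp
    from large_mean_on_interval[OF w pos r'(1,2) this r'(3)]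
    obtain h where "0 < h" "h < 2 * pi" "\<theta> / 21 * h < integral {s-h..s+h} (\<lambda>t. Re (w (cis t)))" by blast
    thus ?thesis unfolding v_def by blast
  qed
  then obtain h where h: "\<And>s. s \<in> K \<Longrightarrow> 0 < h s \<and> h s < 2 * pi \<and> \<theta> / 21 * h s < integral {s - h s..s + h s} v"
    by metis
  \<comment> \<open>Vitali's lemma: the chosen intervals are disjoint, so their integrals add up to
    at most the integral over three periods, while their fivefold enlargements still cover
    \<open>K\<close>.\<close>
  obtain C where C: "countable C" "C \<subseteq> K" "pairwise (\<lambda>i j. disjnt (cball i (h i)) (cball j (h j))) C"
    "K \<subseteq> (\<Union>i\<in>C. cball i (5 * h i))"
  proof -
    have K1: "K \<subseteq> (\<Union>i\<in>K. cball i (h i))"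
    proof
      fix i assume "i \<in> K"
      moreover from this have "i \<in> cball i (h i)" using h[of i] by simp
      ultimately show "i \<in> (\<Union>i\<in>K. cball i (h i))" by blast
    qed
    have K2: "0 < h i \<and> h i \<le> 2 * pi" if "i \<in> K" for i using h[OF that] by simp
    show ?thesis
      by (rule Vitali_covering_lemma_cballs[where S = K and K = K and a = "\<lambda>i. i" and r = h and B = "2 * pi", OF K1 K2])
         (blast intro: that)+
  qed
  \<comment> \<open>The factor 6 in place of 5 makes the discs open, so that compactness yields a
    finite subcover. The final constant is 3024 = 6 * 21 * 24.\<close>
  have "E \<subseteq> (\<Union>s\<in>C. ball (cis s) (6 * h s))"
  proof
    fix \<zeta> assume z: "\<zeta> \<in> E"
    hence "norm \<zeta> = 1" using E by auto
    hence t: "Arg2pi \<zeta> \<in> {0..2*pi}" "\<zeta> = cis (Arg2pi \<zeta>)"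
      using Arg2pi[of \<zeta>] by (auto simp: cis_conv_exp is_Arg_def)
    define t where "t = Arg2pi \<zeta>"
    note t = t[folded t_def]
    hence "t \<in> K" using z by (auto simp: K_def)
    then obtain s where s: "s \<in> C" "t \<in> cball s (5 * h s)" using C(4) by blast
    hence "s \<in> K" "\<bar>s - t\<bar> \<le> 5 * h s" using C(2) by (auto simp: dist_real_def)
    hence "norm (cis s - cis t) < 6 * h s" using norm_cis_diff_le[of s t] h[of s] by linarith
    hence "norm (cis s - \<zeta>) < 6 * h s" using t(2) by simp
    hence "\<zeta> \<in> ball (cis s) (6 * h s)" by (simp add: dist_norm)
    thus "\<zeta> \<in> (\<Union>s\<in>C. ball (cis s) (6 * h s))" using s(1) by blast
  qed
  then obtain D where D: "D \<subseteq> C" "finite D" "E \<subseteq> (\<Union>s\<in>D. ball (cis s) (6 * h s))"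
    using compactE_image[OF E(1), of C "\<lambda>s. ball (cis s) (6 * h s)"] by auto
  have DK: "s \<in> K" if "s \<in> D" for s using that D C by blast
  have int: "v integrable_on {a..b}" for a b unfolding v_def
    by (intro integrable_continuous_real continuous_intros continuous_on_compose2[OF w(2)]) auto
  have v0: "0 \<le> v t" for t unfolding v_def by (rule pos) simp
  have "\<theta> / 21 * sum h D = (\<Sum>s\<in>D. \<theta> / 21 * h s)" by (simp add: sum_distrib_left)
  also have "\<dots> \<le> (\<Sum>s\<in>D. integral (cball s (h s)) v)"
  proof (rule sum_mono)
    fix s assume "s \<in> D"
    thus "\<theta> / 21 * h s \<le> integral (cball s (h s)) v"
      using h[OF DK] by (simp add: cball_eq_atLeastAtMost less_imp_le)
  qed
  also have "\<dots> \<le> integral {-(2*pi)..4*pi} v"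
  proof (rule has_integral_subset_le)
    show "(v has_integral (\<Sum>s\<in>D. integral (cball s (h s)) v)) (\<Union>s\<in>D. cball s (h s))"
    proof (rule has_integral_UN[OF D(2)])
      show "pairwise (\<lambda>i i'. negligible (cball i (h i) \<inter> cball i' (h i'))) D"
        using C(3) D(1) by (auto simp: pairwise_def disjnt_def subset_iff)
    qed (use int in \<open>auto simp: cball_eq_atLeastAtMost\<close>)
    show "(\<Union>s\<in>D. cball s (h s)) \<subseteq> {-(2*pi)..4*pi}"
    proof
      fix x assume "x \<in> (\<Union>s\<in>D. cball s (h s))"
      then obtain s where s: "s \<in> D" "x \<in> cball s (h s)" by blast
      hence "s \<in> K" using DK by blast
      hence "s \<in> {0..2*pi}" "h s < 2 * pi" using h[of s] by (simp_all add: K_def)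
      thus "x \<in> {-(2*pi)..4*pi}" using s(2) by (auto simp: cball_eq_atLeastAtMost)
    qed
  qed (use int v0 in \<open>auto intro: integrable_integral\<close>)
  also have "\<dots> = 6 * pi * Re (w 0)" unfolding v_def by (rule integral_three_periods[OF w])
  also have "\<dots> \<le> 24 * norm (w 0)"
    using complex_Re_le_cmod[of "w 0"] pi_less_4 pos[of 0] by (intro mult_mono) auto
  finally have sumD: "6 * sum h D \<le> 3024 * norm (w 0) / \<theta>" using \<theta> by (simp add: field_simps)
  define P where "P = (\<lambda>s. (cis s, 6 * h s)) ` D"
  show ?thesis
  proof (rule that[of P])
    show "arcs P" using h[OF DK] D(2) unfolding arcs_def P_def by auto
    show "fst ` P \<subseteq> E" using DK by (auto simp: P_def K_def)
    show "E \<subseteq> (\<Union>p\<in>P. ball (fst p) (snd p))" using D by (auto simp: P_def)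
    have "sum snd P \<le> sum (snd \<circ> (\<lambda>s. (cis s, 6 * h s))) D" unfolding P_def
      using h[OF DK] D(2) by (intro sum_image_le) (auto simp: less_imp_le)
    also have "\<dots> = 6 * sum h D" by (simp add: sum_distrib_left)
    finally show "sum snd P \<le> 3024 * norm (w 0) / \<theta>" using sumD by simp
  qed
qed

subsection \<open>Functions dominated on radii by their boundary real part\<close>

text \<open>A pair \<open>(c, \<delta>)\<close> in \<open>P\<close> stands for the disc \<open>ball c \<delta>\<close>. The last clause is the domination of the
  radial maximal function by the boundary real part.\<close>

definition adapted :: "(complex \<times> real) set \<Rightarrow> real \<Rightarrow> real \<Rightarrow> real \<Rightarrow> (complex \<Rightarrow> complex) \<Rightarrow> bool" where
  "adapted P d \<eta> e g \<longleftrightarrow> g holomorphic_on ball 0 1 \<and> continuous_on (cball 0 1) g \<and>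
     (\<forall>z\<in>cball 0 1. norm (g z) \<le> 2 \<and> 0 \<le> Re (g z)) \<and>
     (\<forall>z\<in>sphere 0 1. \<forall>p\<in>P. z \<in> ball (fst p) (snd p) \<longrightarrow> 1/5 \<le> Re (g z)) \<and>
     (\<forall>z\<in>cball 0 1. (\<forall>p\<in>P. d \<le> norm (z - fst p)) \<longrightarrow> norm (g z) \<le> \<eta>) \<and>
     (\<forall>\<zeta>\<in>sphere 0 1. \<forall>r\<in>{0..1}. norm (g (of_real r * \<zeta>)) \<le> 20 * Re (g \<zeta>) + e)"

lemma adapted_empty: "0 \<le> \<eta> \<Longrightarrow> 0 \<le> e \<Longrightarrow> adapted {} d \<eta> e (\<lambda>_. 0)"
  by (simp add: adapted_def)

text \<open>The point \<open>of_real r * \<zeta>\<close> is at distance \<open>1 - r\<close> from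
  \<open>\<zeta>\<close> and at least that far from every point of the circle. Thus distance from a
  centre persists, up to a factor 2, along the whole radius.\<close>

lemma norm_radial_diff_ge:
  fixes \<zeta> c :: complex
  assumes "norm \<zeta> = 1" "norm c = 1" "r \<in> {0..1}"
  shows "norm (\<zeta> - c) \<le> 2 * norm (of_real r * \<zeta> - c)"
proof -
  have "norm (of_real r * \<zeta>) = r" using assms by (simp add: norm_mult)
  moreover have "\<zeta> - of_real r * \<zeta> = of_real (1 - r) * \<zeta>" by (simp add: algebra_simps)
  hence "norm (\<zeta> - of_real r * \<zeta>) = norm (of_real (1 - r) :: complex) * norm \<zeta>" by (metis norm_mult)
  hence "norm (\<zeta> - of_real r * \<zeta>) = 1 - r" using assms unfolding norm_of_real by simp
  moreover have "norm c - norm (of_real r * \<zeta>) \<le> norm (of_real r * \<zeta> - c)"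
    using norm_triangle_ineq2[of c "of_real r * \<zeta>"] by (simp add: norm_minus_commute)
  moreover have "norm (\<zeta> - c) \<le> norm (\<zeta> - of_real r * \<zeta>) + norm (of_real r * \<zeta> - c)"
    using norm_triangle_ineq[of "\<zeta> - of_real r * \<zeta>" "of_real r * \<zeta> - c"] by simp
  ultimately show ?thesis using assms by linarith
qed

text \<open>Here \<open>u = w / (1 + w)\<close> is the bounded function that enters the
  construction, and \<open>w\<close> is kept for the maximal estimate; 1/5 is the value of
  \<open>x / (1 + x)\<close> at 1/4.\<close>

lemma bounded_bump:
  assumes P: "arcs P" "P \<noteq> {}"
  shows "\<exists>w u. w holomorphic_on ball 0 1 \<and> continuous_on (cball 0 1) w \<and>
    u holomorphic_on ball 0 1 \<and> continuous_on (cball 0 1) u \<and>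
    (\<forall>z\<in>cball 0 1. norm (w z) \<le> 2 * Re (w z) \<and>
      norm (u z) \<le> 1 \<and> norm (u z) \<le> norm (w z) \<and> 0 \<le> Re (u z) \<and>
      (\<forall>p\<in>P. z \<in> ball (fst p) (snd p) \<longrightarrow> 1/5 \<le> Re (u z)) \<and>
      (\<forall>d>0. (\<forall>p\<in>P. d \<le> norm (z - fst p)) \<longrightarrow> norm (w z) \<le> sqrt (sum snd P / d)))"
proof -
  obtain w where w: "w holomorphic_on ball 0 1" "continuous_on (cball 0 1) w"
    and w1: "\<forall>z\<in>cball 0 1. 0 < Re (w z) \<and> norm (w z) \<le> 2 * Re (w z) \<and>
       (\<forall>p\<in>P. norm (z - fst p) \<le> snd p \<longrightarrow> 1/4 \<le> Re (w z)) \<and>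
       (\<forall>d>0. (\<forall>p\<in>P. d \<le> norm (z - fst p)) \<longrightarrow> norm (w z) \<le> sqrt (sum snd P / d))"
    using sectorial_bump[OF P] by (elim exE conjE)
  have re: "0 \<le> Re (w z)" if "z \<in> cball 0 1" for z using w1 that by (meson less_imp_le)
  have nz: "1 + w z \<noteq> 0" if "z \<in> cball 0 1" for z using cayley_half_plane(1)[OF re[OF that]] .
  show ?thesis
  proof (rule exI[of _ w], rule exI[of _ "\<lambda>z. w z / (1 + w z)"], intro conjI w ballI allI impI)
    show "(\<lambda>z. w z / (1 + w z)) holomorphic_on ball 0 1"
      using w nz by (intro holomorphic_intros) auto
    show "continuous_on (cball 0 1) (\<lambda>z. w z / (1 + w z))"
      using w nz by (intro continuous_intros) auto
    fix z :: complex assume z: "z \<in> cball 0 1"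
    show "norm (w z / (1 + w z)) \<le> 1" "norm (w z / (1 + w z)) \<le> norm (w z)" "0 \<le> Re (w z / (1 + w z))"
      using cayley_half_plane(2,3,5)[OF re[OF z]] by blast+
    show "norm (w z) \<le> 2 * Re (w z)" using w1 z by blast
    show "norm (w z) \<le> sqrt (sum snd P / d)" if "0 < d" "\<forall>p\<in>P. d \<le> norm (z - fst p)" for d
      using w1 z that by blast
    fix p assume p: "p \<in> P" "z \<in> ball (fst p) (snd p)"
    hence "norm (z - fst p) \<le> snd p" by (simp add: dist_norm norm_minus_commute)
    hence "1/4 \<le> Re (w z)" using w1 z p by blast
    hence "1/5 \<le> Re (w z) / (1 + Re (w z))" by (simp add: field_simps)
    also have "\<dots> \<le> Re (w z / (1 + w z))" using cayley_half_plane(4)[OF re[OF z]] .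
    finally show "1/5 \<le> Re (w z / (1 + w z))" .
  qed
qed

text \<open>The set is the projection to the circle of a closed subset of the compact product of
  circle and radius interval.\<close>

lemma compact_radial_superlevel:
  assumes "continuous_on (cball 0 1) (w :: complex \<Rightarrow> complex)"
  shows "compact {\<zeta> \<in> sphere 0 1. \<exists>r\<in>{0..1}. \<theta> \<le> norm (w (of_real r * \<zeta>))}"
proof -
  define S where "S = sphere (0::complex) 1 \<times> {0..1::real}"
  define f where "f x = norm (w (of_real (snd x) * fst x))" for x :: "complex \<times> real"
  have "continuous_on S f" unfolding f_def S_def
    by (intro continuous_intros continuous_on_compose2[OF assms]) (auto simp: norm_mult)
  moreover have "compact S" unfolding S_def by (intro compact_Times) auto
  ultimately have "compact (S \<inter> f -` {\<theta>..})"
    by (meson closed_atLeast closedin_compact continuous_closedin_preimage)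
  hence "compact (fst ` (S \<inter> f -` {\<theta>..}))"
    by (intro compact_continuous_image continuous_intros)
  also have "fst ` (S \<inter> f -` {\<theta>..}) = {\<zeta> \<in> sphere 0 1. \<exists>r\<in>{0..1}. \<theta> \<le> norm (w (of_real r * \<zeta>))}"
    by (force simp: S_def f_def)
  finally show ?thesis .
qed

text \<open>Each step repairs the set \<open>E\<close> where the radial maximal function of the bump is not small: half of
  a function that is large on \<open>E\<close> is added. After \<open>k\<close> steps the unrepaired excursions have size
  \<open>2\<^sup>-\<^sup>k\<close>. The exceptional sets may grow in each of the finitely many steps; the smallness of
  \<open>\<beta>\<close> absorbs this.\<close>

lemma adapted_exists:
  "0 < d \<Longrightarrow> 0 < \<eta> \<Longrightarrow>
     \<exists>\<beta>>0. \<forall>P. arcs P \<longrightarrow> sum snd P \<le> \<beta> \<longrightarrow> (\<exists>g. adapted P d \<eta> (\<eta> + 1 / 2 ^ k) g)"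
proof (induction k arbitrary: d)
  case 0
  show ?case
  \<comment> \<open>This choice makes \<open>sqrt (sum snd P / d)\<close> at most
    \<open>\<eta>\<close>. Domination is trivial at depth 0, because the allowed error exceeds
    1.\<close>
  proof (intro exI[of _ "\<eta>\<^sup>2 * d"] conjI allI impI)
    fix P assume P: "arcs P" "sum snd P \<le> \<eta>\<^sup>2 * d"
    show "\<exists>g. adapted P d \<eta> (\<eta> + 1 / 2 ^ 0) g"
    proof (cases "P = {}")
      case True
      thus ?thesis using adapted_empty[of \<eta> "\<eta> + 1 / 2 ^ 0" d] 0 by auto
    next
      case False
      obtain w u where w: "w holomorphic_on ball 0 1" "continuous_on (cball 0 1) w"
        and u: "u holomorphic_on ball 0 1" "continuous_on (cball 0 1) u"
        and uw: "\<forall>z\<in>cball 0 1. norm (w z) \<le> 2 * Re (w z) \<and>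
          norm (u z) \<le> 1 \<and> norm (u z) \<le> norm (w z) \<and> 0 \<le> Re (u z) \<and>
          (\<forall>p\<in>P. z \<in> ball (fst p) (snd p) \<longrightarrow> 1/5 \<le> Re (u z)) \<and>
          (\<forall>d>0. (\<forall>p\<in>P. d \<le> norm (z - fst p)) \<longrightarrow> norm (w z) \<le> sqrt (sum snd P / d))"
        using bounded_bump[OF P(1) False] by (elim exE conjE)
      have u1: "norm (u z) \<le> 1 \<and> norm (u z) \<le> norm (w z) \<and> 0 \<le> Re (u z)"
        if "z \<in> cball 0 1" for z using uw that by blast
      have u2: "1/5 \<le> Re (u z)" if "z \<in> cball 0 1" "p \<in> P" "z \<in> ball (fst p) (snd p)" for z p
        using uw that by blast
      have far: "norm (w z) \<le> sqrt (sum snd P / d)"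
        if "z \<in> cball 0 1" "0 < d" "\<And>p. p \<in> P \<Longrightarrow> d \<le> norm (z - fst p)" for z d
        using uw that by blast
      have "adapted P d \<eta> (\<eta> + 1 / 2 ^ 0) u" unfolding adapted_def
      proof (intro conjI ballI impI)
        show "u holomorphic_on ball 0 1" "continuous_on (cball 0 1) u" by fact+
      next
        fix z :: complex assume z: "z \<in> cball 0 1"
        show "norm (u z) \<le> 2" "0 \<le> Re (u z)" using u1[OF z] by auto
        assume "\<forall>p\<in>P. d \<le> norm (z - fst p)"
        hence "norm (w z) \<le> sqrt (sum snd P / d)" using far z 0 by blast
        also have "\<dots> \<le> sqrt (\<eta>\<^sup>2)" using P 0 by (intro real_sqrt_le_mono) (simp add: field_simps)
        finally show "norm (u z) \<le> \<eta>" using u1[OF z] 0 by simp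
      next
        fix z p assume "z \<in> sphere (0::complex) 1" "p \<in> P" "z \<in> ball (fst p) (snd p)"
        thus "1/5 \<le> Re (u z)" using u2[of z p] by auto
      next
        fix \<zeta> :: complex and r :: real assume z: "\<zeta> \<in> sphere 0 1" "r \<in> {0..1}"
        hence "of_real r * \<zeta> \<in> cball 0 1" "\<zeta> \<in> cball 0 1" by (auto simp: norm_mult)
        hence "norm (u (of_real r * \<zeta>)) \<le> 1" "0 \<le> Re (u \<zeta>)" using u1 by blast+
        thus "norm (u (of_real r * \<zeta>)) \<le> 20 * Re (u \<zeta>) + (\<eta> + 1 / 2 ^ 0)" using 0 by simp
      qed
      thus ?thesis by blast
    qed
  qed (use 0 in simp)
next
  case (Suc k)
  \<comment> \<open>The repair discs will be centred within \<open>d / 2\<close> of the centres of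
    \<open>P\<close>; a point at distance \<open>d\<close> from the latter keeps distance
    \<open>d / 2\<close> from the former.\<close>
  from Suc.IH[of "d/2"] Suc.prems obtain \<beta>' where \<beta>': "0 < \<beta>'"
    and IH: "\<And>P. arcs P \<Longrightarrow> sum snd P \<le> \<beta>' \<Longrightarrow> \<exists>g. adapted P (d/2) \<eta> (\<eta> + 1 / 2 ^ k) g"
    by auto
  define \<theta> where "\<theta> = \<eta> / 2"
  \<comment> \<open>The first entry makes \<open>w\<close> at most \<open>\<eta> / 4\<close> at
    distance \<open>d / 4\<close> from the centres. The second controls \<open>w\<close> at 0, which
    has distance 1 from every centre, so that the repair discs have total radius at most
    \<open>\<beta>'\<close>.\<close>
  define \<beta> where "\<beta> = min (d * (\<eta>/4)\<^sup>2 / 4) ((\<beta>' * \<theta> / 3024)\<^sup>2)"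
  have \<theta>: "0 < \<theta>" using Suc.prems by (simp add: \<theta>_def)
  show ?case
  proof (intro exI[of _ \<beta>] conjI allI impI)
    show "0 < \<beta>" using Suc.prems \<beta>' \<theta> by (simp add: \<beta>_def)
    fix P assume P: "arcs P" "sum snd P \<le> \<beta>"
    have P1: "norm (fst p) = 1" if "p \<in> P" for p using P that by (simp add: arcs_def)
    show "\<exists>g. adapted P d \<eta> (\<eta> + 1 / 2 ^ Suc k) g"
    proof (cases "P = {}")
      case True
      moreover have "0 \<le> \<eta>" "0 \<le> \<eta> + 1 / 2 ^ Suc k" using Suc.prems by simp_all
      ultimately show ?thesis using adapted_empty by blast
    next
      case False
      obtain w u where w: "w holomorphic_on ball 0 1" "continuous_on (cball 0 1) w"
        and u: "u holomorphic_on ball 0 1" "continuous_on (cball 0 1) u"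
        and uw: "\<forall>z\<in>cball 0 1. norm (w z) \<le> 2 * Re (w z) \<and>
          norm (u z) \<le> 1 \<and> norm (u z) \<le> norm (w z) \<and> 0 \<le> Re (u z) \<and>
          (\<forall>p\<in>P. z \<in> ball (fst p) (snd p) \<longrightarrow> 1/5 \<le> Re (u z)) \<and>
          (\<forall>d>0. (\<forall>p\<in>P. d \<le> norm (z - fst p)) \<longrightarrow> norm (w z) \<le> sqrt (sum snd P / d))"
        using bounded_bump[OF P(1) False] by (elim exE conjE)
      have sec: "norm (w z) \<le> 2 * Re (w z)" if "z \<in> cball 0 1" for z using uw that by blast
      have u1: "norm (u z) \<le> 1 \<and> norm (u z) \<le> norm (w z) \<and> 0 \<le> Re (u z)"
        if "z \<in> cball 0 1" for z using uw that by blast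
      have u2: "1/5 \<le> Re (u z)" if "z \<in> cball 0 1" "p \<in> P" "z \<in> ball (fst p) (snd p)" for z p
        using uw that by blast
      have far: "norm (w z) \<le> sqrt (sum snd P / d)"
        if "z \<in> cball 0 1" "0 < d" "\<And>p. p \<in> P \<Longrightarrow> d \<le> norm (z - fst p)" for z d
        using uw that by blast
      define E where "E = {\<zeta> \<in> sphere 0 1. \<exists>r\<in>{0..1}. \<theta> \<le> norm (w (of_real r * \<zeta>))}"
      have far4: "norm (w z) \<le> \<eta> / 4" if "z \<in> cball 0 1" "\<And>p. p \<in> P \<Longrightarrow> d / 4 \<le> norm (z - fst p)" for z
      proof -
        have "norm (w z) \<le> sqrt (sum snd P / (d/4))" using that Suc.prems by (intro far) auto
        also have "\<dots> \<le> sqrt ((\<eta>/4)\<^sup>2)"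
          using P Suc.prems by (intro real_sqrt_le_mono) (auto simp: \<beta>_def field_simps)
        finally show ?thesis using Suc.prems by simp
      qed
      have near: "\<exists>p\<in>P. norm (\<zeta> - fst p) < d / 2" if "\<zeta> \<in> E" for \<zeta>
      proof (rule ccontr)
        assume "\<not> ?thesis"
        hence *: "d / 2 \<le> norm (\<zeta> - fst p)" if "p \<in> P" for p using that by force
        obtain r where r: "r \<in> {0..1}" "\<theta> \<le> norm (w (of_real r * \<zeta>))" "norm \<zeta> = 1"
          using \<open>\<zeta> \<in> E\<close> by (auto simp: E_def)
        have "norm (w (of_real r * \<zeta>)) \<le> \<eta> / 4"
        proof (rule far4)
          show "of_real r * \<zeta> \<in> cball 0 1" using r by (simp add: norm_mult)
          show "d / 4 \<le> norm (of_real r * \<zeta> - fst p)" if "p \<in> P" for p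
            using *[OF that] norm_radial_diff_ge[OF r(3) P1[OF that] r(1)] by simp
        qed
        thus False using r Suc.prems by (simp add: \<theta>_def)
      qed
      have "compact E" unfolding E_def by (rule compact_radial_superlevel[OF w(2)])
      moreover have "E \<subseteq> sphere 0 1" unfolding E_def by blast
      moreover have "\<exists>r\<in>{0..1}. \<theta> \<le> norm (w (of_real r * \<zeta>))" if "\<zeta> \<in> E" for \<zeta>
        using that by (simp add: E_def)
      ultimately obtain P' where P': "arcs P'" "fst ` P' \<subseteq> E" "E \<subseteq> (\<Union>p\<in>P'. ball (fst p) (snd p))"
        "sum snd P' \<le> 3024 * norm (w 0) / \<theta>"
        using weak_type_cover[OF w sec _ _ \<theta>, of E] by blast
      have "norm (w 0) \<le> sqrt (sum snd P / 1)" by (rule far) (auto simp: P1)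
      also have "\<dots> \<le> sqrt ((\<beta>' * \<theta> / 3024)\<^sup>2)" using P by (intro real_sqrt_le_mono) (simp add: \<beta>_def)
      also have "\<dots> = \<beta>' * \<theta> / 3024" using \<beta>' \<theta> by simp
      finally have "3024 * norm (w 0) / \<theta> \<le> \<beta>'" using \<theta> by (simp add: field_simps)
      hence "sum snd P' \<le> \<beta>'" using P'(4) by linarith
      then obtain g where g: "adapted P' (d/2) \<eta> (\<eta> + 1 / 2 ^ k) g" using IH P'(1) by blast
      note g' = g[unfolded adapted_def]
      \<comment> \<open>The weight 1/2 keeps the bound 2 stable, as 1 + 2/2 = 2, and halves the
        error inherited from \<open>g\<close>.\<close>
      have "adapted P d \<eta> (\<eta> + 1 / 2 ^ Suc k) (\<lambda>z. u z + g z / 2)"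
        unfolding adapted_def
      proof (intro conjI ballI impI)
        show "(\<lambda>z. u z + g z / 2) holomorphic_on ball 0 1" using u g' by (intro holomorphic_intros) auto
        show "continuous_on (cball 0 1) (\<lambda>z. u z + g z / 2)" using u g' by (intro continuous_intros) auto
      next
        fix z :: complex assume z: "z \<in> cball 0 1"
        have n: "norm (u z + g z / 2) \<le> norm (u z) + norm (g z) / 2"
          using norm_triangle_ineq[of "u z" "g z / 2"] by (simp add: norm_divide)
        thus "norm (u z + g z / 2) \<le> 2" "0 \<le> Re (u z + g z / 2)" using u1[OF z] g' z by fastforce+
        assume away: "\<forall>p\<in>P. d \<le> norm (z - fst p)"
        have away2: "d / 4 \<le> norm (z - fst p)" if "p \<in> P" for p using away that Suc.prems by fastforce
        have "norm (u z) \<le> \<eta> / 4" using far4[OF z away2] u1[OF z] by linarith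
        moreover have "d / 2 \<le> norm (z - fst q)" if q: "q \<in> P'" for q
        proof -
          obtain p where p: "p \<in> P" "norm (fst q - fst p) < d / 2" using near P'(2) q by blast
          have "d \<le> norm (z - fst p)" using away p by blast
          also have "\<dots> \<le> norm (z - fst q) + norm (fst q - fst p)"
            using norm_triangle_ineq[of "z - fst q" "fst q - fst p"] by simp
          finally show ?thesis using p by simp
        qed
        hence "norm (g z) \<le> \<eta>" using g' z by blast
        ultimately show "norm (u z + g z / 2) \<le> \<eta>" using n Suc.prems by simp
      next
        fix z p assume z: "z \<in> sphere (0::complex) 1" "p \<in> P" "z \<in> ball (fst p) (snd p)"
        hence "1/5 \<le> Re (u z)" "0 \<le> Re (g z)" using u2[of z p] g' by auto
        thus "1/5 \<le> Re (u z + g z / 2)" by simp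
      next
        fix \<zeta> :: complex and r :: real assume z: "\<zeta> \<in> sphere 0 1" "r \<in> {0..1}"
        hence zc: "of_real r * \<zeta> \<in> cball 0 1" "\<zeta> \<in> cball 0 1" by (auto simp: norm_mult)
        have n: "norm (u (of_real r * \<zeta>) + g (of_real r * \<zeta>) / 2) \<le> norm (u (of_real r * \<zeta>)) + norm (g (of_real r * \<zeta>)) / 2"
          using norm_triangle_ineq[of "u (of_real r * \<zeta>)" "g (of_real r * \<zeta>) / 2"] by (simp add: norm_divide)
        have u0: "0 \<le> Re (u \<zeta>)" using u1 zc by blast
        show "norm (u (of_real r * \<zeta>) + g (of_real r * \<zeta>) / 2) \<le> 20 * Re (u \<zeta> + g \<zeta> / 2) + (\<eta> + 1 / 2 ^ Suc k)"
        \<comment> \<open>On \<open>E\<close> the term \<open>10 * Re (g \<zeta>)\<close> is at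
          least 2 and absorbs the trivial bound. Off \<open>E\<close>, \<open>u\<close> contributes
          at most \<open>\<eta> / 2\<close> on the radius, and half of the domination of
          \<open>g\<close> supplies the rest.\<close>
        proof (cases "\<zeta> \<in> E")
          case True
          then obtain q where "q \<in> P'" "\<zeta> \<in> ball (fst q) (snd q)" using P'(3) by blast
          hence "1/5 \<le> Re (g \<zeta>)" using g' z by blast
          moreover have "norm (u (of_real r * \<zeta>)) \<le> 1" "norm (g (of_real r * \<zeta>)) \<le> 2" using u1 g' zc by blast+
          moreover have "0 < 1 / (2::real) ^ Suc k" by simp
          moreover have "20 * Re (u \<zeta> + g \<zeta> / 2) = 20 * Re (u \<zeta>) + 10 * Re (g \<zeta>)" by simp
          ultimately show ?thesis using n u0 Suc.prems by linarith
        next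
          case False
          hence "norm (w (of_real r * \<zeta>)) < \<theta>" using z by (force simp: E_def)
          hence "norm (u (of_real r * \<zeta>)) \<le> \<eta> / 2" using u1[OF zc(1)] by (simp add: \<theta>_def)
          moreover have "norm (g (of_real r * \<zeta>)) \<le> 20 * Re (g \<zeta>) + (\<eta> + 1 / 2 ^ k)" using g' z by blast
          ultimately show ?thesis using n u0 by simp
        qed
      qed
      thus ?thesis by blast
    qed
  qed
qed

subsection \<open>Covering null sets by batches of arcs\<close>

text \<open>An open set of measure below \<open>e / 2\<close> around \<open>S\<close> contains
  nonoverlapping intervals that cover \<open>S\<close>, each meeting \<open>S\<close>; they are
  replaced by balls centred at points of \<open>S\<close>. The index set \<open>J\<close> allows for
  finitely many intervals.\<close>

lemma small_interval_cover:
  fixes S :: "real set"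
  assumes S: "negligible S" "S \<subseteq> {a..b}" "a < b" and e: "0 < e"
  shows "\<exists>(s :: nat \<Rightarrow> real) \<delta> J. (\<forall>j\<in>J. s j \<in> S \<and> 0 < \<delta> j) \<and> (\<forall>j. 0 \<le> \<delta> j) \<and>
    (\<forall>n. sum \<delta> {..<n} \<le> e) \<and> S \<subseteq> (\<Union>j\<in>J. ball (s j) (\<delta> j))"
proof -
  have "S \<in> sets lebesgue" using S(1) by (simp add: negligible_imp_sets)
  then obtain U where U: "open U" "S \<subseteq> U" "U - S \<in> lmeasurable" "emeasure lebesgue (U - S) < ennreal (e/2)"
    using sets_lebesgue_outer_open[of S "e/2"] e by auto
  have mU: "measure lebesgue U < e / 2" "U \<in> lmeasurable"
  proof -
    have null: "S \<in> null_sets lebesgue" using S(1) by (simp add: negligible_iff_null_sets)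
    have Ueq: "U = (U - S) \<union> S" using U(2) by blast
    show L: "U \<in> lmeasurable"
      by (subst Ueq, rule fmeasurable.Un[OF U(3)]) (use S(1) negligible_iff_measure in blast)
    have "measure lebesgue U = measure lebesgue (U - S)"
      using L null by (simp add: measure_Diff_null_set fmeasurableD)
    thus "measure lebesgue U < e / 2"
      using U(3,4) e by (simp add: emeasure_eq_measure2 ennreal_less_iff)
  qed
  \<comment> \<open>This gauge forces every interval attached to a point of \<open>S\<close> to lie
    inside \<open>U\<close>.\<close>
  define g where "g x = (if x \<in> U then U else UNIV)" for x :: real
  have g: "gauge g" unfolding g_def gauge_def using U(1) by auto
  have ab: "S \<subseteq> cbox a b" "box a b \<noteq> {}" using S by auto
  obtain D where D: "countable D"
    "\<forall>K\<in>D. interior K \<noteq> {} \<and> (\<exists>c d. K = cbox c d)"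
    "pairwise (\<lambda>A B. interior A \<inter> interior B = {}) D"
    "\<forall>K\<in>D. \<exists>x \<in> S \<inter> K. K \<subseteq> g x" "S \<subseteq> \<Union>D"
  proof -
    show ?thesis
    proof (rule covering_lemma[OF ab g], goal_cases)
      case (1 D)
      show ?case by (rule that[of D]) (use 1 in blast)+
    qed
  qed
  have DU: "K \<subseteq> U" if "K \<in> D" for K
  proof -
    obtain x where "x \<in> S" "K \<subseteq> g x" using D(4) \<open>K \<in> D\<close> by blast
    moreover from this have "x \<in> U" using U(2) by blast
    ultimately show ?thesis by (simp add: g_def)
  qed
  have fin: "sum (measure lebesgue) E \<le> e / 2" if "finite E" "E \<subseteq> D" for E
  proof -
    have "E division_of \<Union>E"
    proof (rule division_ofI)
      fix K assume K: "K \<in> E"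
      show "K \<subseteq> \<Union>E" using K by blast
      have "interior K \<noteq> {}" "\<exists>c d. K = cbox c d" using D(2) K that by blast+
      thus "K \<noteq> {}" "\<exists>c d. K = cbox c d" using interior_subset by auto
      fix L assume "L \<in> E" "K \<noteq> L"
      thus "interior K \<inter> interior L = {}" using D(3) K that unfolding pairwise_def by blast
    qed (use that in auto)
    hence "sum (measure lebesgue) E = measure lebesgue (\<Union>E)"
      by (rule content_division)
    also have "\<dots> \<le> measure lebesgue U"
    proof (rule measure_mono_fmeasurable[OF _ _ mU(2)])
      show "\<Union>E \<subseteq> U" using that DU by blast
      have "E \<subseteq> sets lebesgue"
      proof
        fix K assume "K \<in> E"
        hence "K \<in> D" using that by blast
        hence "\<exists>c d. K = cbox c d" using D(2) by simp
        thus "K \<in> sets lebesgue" by fastforce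
      qed
      thus "\<Union>E \<in> sets lebesgue" using that(1) sets.finite_Union by blast
    qed
    finally show ?thesis using mU by simp
  qed
  define x where "x K = (SOME x. x \<in> S \<inter> K)" for K
  have x: "x K \<in> S" "x K \<in> K" if "K \<in> D" for K
  proof -
    have "\<exists>x. x \<in> S \<inter> K" using D(4) that by blast
    hence "x K \<in> S \<inter> K" unfolding x_def by (rule someI_ex)
    thus "x K \<in> S" "x K \<in> K" by auto
  qed
  define J where "J = to_nat_on D ` D"
  define \<kappa> where "\<kappa> = from_nat_into D"
  have \<kappa>: "\<kappa> j \<in> D" if "j \<in> J" for j
    using that from_nat_into_to_nat_on[OF D(1)] unfolding J_def \<kappa>_def by force
  have inj: "inj_on \<kappa> J"
    unfolding J_def \<kappa>_def using from_nat_into_to_nat_on[OF D(1)] by (intro inj_onI) force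
  \<comment> \<open>Twice the length, so that the open ball about any point of the closed interval
    contains all of it. Indices outside \<open>J\<close> get radius 0 and do not affect the
    sums.\<close>
  define \<delta> where "\<delta> j = (if j \<in> J then 2 * measure lebesgue (\<kappa> j) else 0)" for j
  have pos: "0 < measure lebesgue K \<and> (\<forall>y\<in>K. \<forall>z\<in>K. \<bar>y - z\<bar> \<le> measure lebesgue K)" if K: "K \<in> D" for K
  proof -
    obtain c d where cd: "K = {c..d}" using D(2) K by (metis box_real(2))
    moreover have "interior K \<noteq> {}" using D(2) K by blast
    hence "c < d" unfolding cd by simp
    ultimately show ?thesis by auto
  qed
  show ?thesis
  proof (rule exI[of _ "\<lambda>j. x (\<kappa> j)"], rule exI[of _ \<delta>], rule exI[of _ J], intro conjI allI ballI)
    fix j assume j: "j \<in> J"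
    show "x (\<kappa> j) \<in> S" using x(1)[OF \<kappa>[OF j]] .
    have "0 < measure lebesgue (\<kappa> j)" using pos[OF \<kappa>[OF j]] by blast
    thus "0 < \<delta> j" using j unfolding \<delta>_def by simp
  next
    show "0 \<le> \<delta> j" for j by (simp add: \<delta>_def)
  next
    fix n
    have "sum \<delta> {..<n} = (\<Sum>j\<in>J \<inter> {..<n}. 2 * measure lebesgue (\<kappa> j))"
      unfolding \<delta>_def by (subst sum.inter_restrict[symmetric]) (auto simp: Int_commute)
    also have "\<dots> = 2 * sum (measure lebesgue) (\<kappa> ` (J \<inter> {..<n}))"
      by (subst sum.reindex) (auto intro: inj_on_subset[OF inj] simp: sum_distrib_left)
    also have "\<dots> \<le> 2 * (e / 2)" using \<kappa> by (intro mult_left_mono fin) auto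
    finally show "sum \<delta> {..<n} \<le> e" by simp
  next
    show "S \<subseteq> (\<Union>j\<in>J. ball (x (\<kappa> j)) (\<delta> j))"
    proof
      fix t assume "t \<in> S"
      then obtain K where K: "K \<in> D" "t \<in> K" using D(5) by blast
      have "to_nat_on D K \<in> J" "\<kappa> (to_nat_on D K) = K"
        using K D(1) by (auto simp: J_def \<kappa>_def)
      moreover have "\<bar>x K - t\<bar> \<le> measure lebesgue K" "0 < measure lebesgue K" using pos[OF K(1)] x[OF K(1)] K(2) by blast+
      ultimately show "t \<in> (\<Union>j\<in>J. ball (x (\<kappa> j)) (\<delta> j))"
        by (intro UN_I[of "to_nat_on D K"]) (auto simp: \<delta>_def dist_real_def)
    qed
  qed
qed

text \<open>One countable cover with summable radii is cut into consecutive finite blocks. Tails of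
  the series are arbitrarily small, so block \<open>i\<close> can start late enough to have total
  radius at most \<open>\<tau> i\<close>.\<close>

lemma null_set_arcs:
  assumes N: "N \<subseteq> sphere 0 1" "negligible {t \<in> {0..2*pi}. cis t \<in> N}" and \<tau>: "\<And>i. 0 < \<tau> i"
  shows "\<exists>P :: nat \<Rightarrow> (complex \<times> real) set.
     (\<forall>i. arcs (P i) \<and> fst ` P i \<subseteq> N \<and> sum snd (P i) \<le> \<tau> i) \<and>
     N \<subseteq> (\<Union>i. \<Union>p\<in>P i. ball (fst p) (snd p))"
proof -
  define S where "S = {t \<in> {0..2*pi}. cis t \<in> N}"
  have "negligible S" unfolding S_def by (rule N(2))
  moreover have "S \<subseteq> {0..2*pi}" "0 < 2 * pi" by (auto simp: S_def)
  ultimately have "\<exists>(s :: nat \<Rightarrow> real) \<delta> J. (\<forall>j\<in>J. s j \<in> S \<and> 0 < \<delta> j) \<and> (\<forall>j. 0 \<le> \<delta> j) \<and>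
    (\<forall>n. sum \<delta> {..<n} \<le> \<tau> 0) \<and> S \<subseteq> (\<Union>j\<in>J. ball (s j) (\<delta> j))"
    using \<tau> by (intro small_interval_cover)
  then obtain s \<delta> :: "nat \<Rightarrow> real" and J where J': "\<forall>j\<in>J. s j \<in> S \<and> 0 < \<delta> j" "\<forall>j. 0 \<le> \<delta> j"
    "\<forall>n. sum \<delta> {..<n} \<le> \<tau> 0" "S \<subseteq> (\<Union>j\<in>J. ball (s j) (\<delta> j))"
    by (elim exE conjE)
  have J: "\<And>j. j \<in> J \<Longrightarrow> s j \<in> S \<and> 0 < \<delta> j" "\<And>j. 0 \<le> \<delta> j"
    "\<And>n. sum \<delta> {..<n} \<le> \<tau> 0" "S \<subseteq> (\<Union>j\<in>J. ball (s j) (\<delta> j))"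
    using J' by blast+
  have "summable \<delta>" using J(2,3) by (rule summableI_nonneg_bounded)
  hence "\<forall>i. \<exists>M. \<forall>m\<ge>M. \<forall>n. sum \<delta> {m..<n} \<le> \<tau> i"
    using \<tau> unfolding summable_Cauchy by (metis abs_ge_self less_imp_le order_trans real_norm_def)
  then obtain M where M: "\<And>i m n. M i \<le> m \<Longrightarrow> sum \<delta> {m..<n} \<le> \<tau> i" by metis
  \<comment> \<open>Block 0 starts at index 0 and relies on the total bound \<open>\<tau> 0\<close>.
    For other \<open>i\<close>, \<open>k i\<close> is at least \<open>M i\<close>, which makes the
    tail small, and at least \<open>i\<close>, so that the blocks reach every index.\<close>
  define k where "k i = (if i = 0 then 0 else i + Max (M ` {..i}))" for i
  have tail: "sum \<delta> {k i..<n} \<le> \<tau> i" for i n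
  proof (cases "i = 0")
    case True
    thus ?thesis using J(3)[of n] by (simp add: k_def atLeast0LessThan)
  next
    case False
    have "M i \<le> Max (M ` {..i})" by (intro Max_ge) auto
    hence "M i \<le> k i" unfolding k_def using False by (simp only: if_False)
    thus ?thesis by (rule M)
  qed
  define A where "A i = J \<inter> {k i..<k (Suc i)}" for i
  define P where "P i = (\<lambda>j. (cis (s j), \<delta> j)) ` A i" for i
  show ?thesis
  proof (intro exI[of _ P] conjI allI)
    fix i
    show "arcs (P i)" "fst ` P i \<subseteq> N" using J(1) by (auto simp: arcs_def P_def A_def S_def)
    have "sum snd (P i) \<le> sum (snd \<circ> (\<lambda>j. (cis (s j), \<delta> j))) (A i)" unfolding P_def
      by (rule sum_image_le) (use J(2) in \<open>auto simp: A_def\<close>)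
    also have "\<dots> = sum \<delta> (A i)" by simp
    also have "\<dots> \<le> sum \<delta> {k i..<k (Suc i)}" using J(2) by (intro sum_mono2) (auto simp: A_def)
    also have "\<dots> \<le> \<tau> i" by (rule tail)
    finally show "sum snd (P i) \<le> \<tau> i" .
  next
    show "N \<subseteq> (\<Union>i. \<Union>p\<in>P i. ball (fst p) (snd p))"
    proof
      fix \<zeta> assume z: "\<zeta> \<in> N"
      define t where "t = Arg2pi \<zeta>"
      have t: "t \<in> {0..2*pi}" "\<zeta> = cis t"
        using z N(1) Arg2pi[of \<zeta>] by (auto simp: t_def cis_conv_exp is_Arg_def subset_iff)
      hence "t \<in> S" using z by (simp add: S_def)
      then obtain j where j: "j \<in> J" "t \<in> ball (s j) (\<delta> j)" using J(4) by blast
      have ex: "j < k (Suc j)" by (simp add: k_def)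
      define m where "m = (LEAST m. j < k m)"
      have m: "j < k m" unfolding m_def using ex by (rule LeastI)
      hence "m \<noteq> 0" by (cases m) (auto simp: k_def)
      then obtain i where i: "m = Suc i" using not0_implies_Suc by blast
      hence "\<not> j < k i" unfolding m_def by (intro not_less_Least) simp
      hence "(cis (s j), \<delta> j) \<in> P i" using j m i by (auto simp: P_def A_def)
      moreover have "\<zeta> \<in> ball (cis (s j)) (\<delta> j)"
        using norm_cis_diff_le[of "s j" t] j(2) t(2) by (simp add: dist_norm)
      ultimately show "\<zeta> \<in> (\<Union>i. \<Union>p\<in>P i. ball (fst p) (snd p))" by force
    qed
  qed
qed

subsection \<open>Radial limits of series\<close>

lemma radial_in_ball: "\<zeta> \<in> sphere 0 1 \<Longrightarrow> r \<in> {0..<1} \<Longrightarrow> of_real r * \<zeta> \<in> ball (0::complex) 1"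
  by (simp add: norm_mult)

lemma eventually_radius: "\<forall>\<^sub>F r in at_left 1. r \<in> {0..<1::real}"
  by (rule eventually_mono[OF eventually_at_left_real[of 0 "1::real"]]) auto

lemma has_radial_limit_continuous:
  assumes "continuous_on (cball 0 1) g" "\<zeta> \<in> sphere 0 1"
  shows "has_radial_limit g \<zeta> (g \<zeta>)"
proof -
  have "continuous_on {0..1} (\<lambda>r. g (of_real r * \<zeta>))"
    using assms(2) by (intro continuous_on_compose2[OF assms(1)] continuous_intros) (auto simp: norm_mult)
  hence "((\<lambda>r. g (of_real r * \<zeta>)) \<longlongrightarrow> g (of_real 1 * \<zeta>)) (at 1 within {0..1})"
    unfolding continuous_on_def by (rule bspec) simp
  moreover have "at 1 within {0..1} = at_left (1::real)"
    by (rule at_within_Icc_at_left) simp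
  ultimately show ?thesis unfolding has_radial_limit_def by simp
qed

text \<open>The M-test on each smaller closed disc; the index from which the bound holds may depend
  on that disc, which suffices for locally uniform convergence.\<close>

lemma
  fixes g :: "nat \<Rightarrow> complex \<Rightarrow> complex"
  assumes hol: "\<And>i. g i holomorphic_on ball 0 1" and M: "summable M"
    and bound: "\<And>s. s < 1 \<Longrightarrow> \<forall>\<^sub>F i in sequentially. \<forall>z\<in>cball 0 s. norm (g i z) \<le> M i"
  shows holomorphic_suminf_disc: "(\<lambda>z. \<Sum>i. g i z) holomorphic_on ball 0 1"
    and summable_disc: "\<And>z. z \<in> ball 0 1 \<Longrightarrow> summable (\<lambda>i. g i z)"
proof -
  have unif: "uniform_limit (cball 0 s) (\<lambda>n z. \<Sum>i<n. g i z) (\<lambda>z. \<Sum>i. g i z) sequentially" if "s < 1" for s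
    by (rule Weierstrass_m_test_ev[OF bound[OF that] M])
  show "(\<lambda>z. \<Sum>i. g i z) holomorphic_on ball 0 1"
  proof (rule holomorphic_uniform_sequence[where f = "\<lambda>n z. \<Sum>i<n. g i z"])
    show "(\<lambda>z. \<Sum>i<n. g i z) holomorphic_on ball 0 1" for n by (intro holomorphic_intros hol)
    fix x :: complex assume x: "x \<in> ball 0 1"
    define d where "d = (1 - norm x) / 2"
    have d: "0 < d" "norm x + d < 1" using x by (auto simp: d_def field_simps)
    have sub: "cball x d \<subseteq> cball 0 (norm x + d)"
      by (auto simp: dist_norm) (metis add.commute add_mono_thms_linordered_semiring(3) norm_minus_commute norm_triangle_sub order_trans)
    have "cball 0 (norm x + d) \<subseteq> ball (0::complex) 1" using d by auto
    thus "\<exists>d>0. cball x d \<subseteq> ball 0 1 \<and> uniform_limit (cball x d) (\<lambda>n z. \<Sum>i<n. g i z) (\<lambda>z. \<Sum>i. g i z) sequentially"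
      using sub d uniform_limit_on_subset[OF unif[OF d(2)] sub] by blast
  qed auto
  fix z :: complex assume z: "z \<in> ball 0 1"
  hence "\<forall>\<^sub>F i in sequentially. norm (g i z) \<le> M i"
    using bound[of "norm z"] by (auto elim: eventually_mono)
  thus "summable (\<lambda>i. g i z)" by (rule summable_comparison_test_ev[OF _ M])
qed

text \<open>The majorant gives uniform convergence along the radius, so the sum and the radial limit
  may be interchanged; it passes to the limits \<open>L i\<close> as well.\<close>

lemma radial_limit_suminf:
  fixes g :: "nat \<Rightarrow> complex \<Rightarrow> complex"
  assumes lim: "\<And>i. has_radial_limit (g i) \<zeta> (L i)" and M: "summable M"
    and bound: "\<forall>\<^sub>F i in sequentially. \<forall>r\<in>{0..<1}. norm (g i (of_real r * \<zeta>)) \<le> M i"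
  shows "summable L" "has_radial_limit (\<lambda>z. \<Sum>i. g i z) \<zeta> (\<Sum>i. L i)"
proof -
  have "\<forall>\<^sub>F i in sequentially. norm (L i) \<le> M i"
    using bound
  proof eventually_elim
    case (elim i)
    have "((\<lambda>r. norm (g i (of_real r * \<zeta>))) \<longlongrightarrow> norm (L i)) (at_left 1)"
      using lim[of i] unfolding has_radial_limit_def by (rule tendsto_norm)
    thus ?case
      by (rule tendsto_upperbound) (use elim eventually_radius in \<open>auto elim: eventually_mono\<close>)
  qed
  thus sL: "summable L" by (rule summable_comparison_test_ev[OF _ M])
  show "has_radial_limit (\<lambda>z. \<Sum>i. g i z) \<zeta> (\<Sum>i. L i)"
    unfolding has_radial_limit_def
  proof (rule swap_uniform_limit'[where F = sequentially])
    show "\<forall>\<^sub>F n in sequentially. ((\<lambda>r. \<Sum>i<n. g i (of_real r * \<zeta>)) \<longlongrightarrow> (\<Sum>i<n. L i)) (at_left 1)"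
      using lim unfolding has_radial_limit_def by (intro always_eventually allI tendsto_sum) auto
    show "(\<lambda>n. \<Sum>i<n. L i) \<longlonglongrightarrow> (\<Sum>i. L i)" using sL by (rule summable_LIMSEQ)
    show "uniform_limit {0..<1} (\<lambda>n r. \<Sum>i<n. g i (of_real r * \<zeta>)) (\<lambda>r. \<Sum>i. g i (of_real r * \<zeta>)) sequentially"
      by (rule Weierstrass_m_test_ev[OF bound M])
  qed (use eventually_radius in auto)
qed

text \<open>Nonnegative real parts let each partial sum bound the full sum from below, and a finite
  partial sum already has a radial limit with real part above any given \<open>Z\<close>.\<close>

lemma radial_divergence_suminf:
  fixes g :: "nat \<Rightarrow> complex \<Rightarrow> complex"
  assumes z: "\<zeta> \<in> sphere 0 1" and lim: "\<And>i. has_radial_limit (g i) \<zeta> (L i)"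
    and pos: "\<And>i z. z \<in> ball 0 1 \<Longrightarrow> 0 \<le> Re (g i z)"
    and sum: "\<And>z. z \<in> ball 0 1 \<Longrightarrow> summable (\<lambda>i. g i z)"
    and L: "\<And>i. 0 \<le> Re (L i)" and div: "\<not> summable (\<lambda>i. Re (L i))"
  shows "filterlim (\<lambda>r. Re (\<Sum>i. g i (of_real r * \<zeta>))) at_top (at_left 1)"
proof (unfold filterlim_at_top, intro allI)
  fix Z :: real
  obtain n where n: "Z < (\<Sum>i<n. Re (L i))"
    using div summableI_nonneg_bounded[of "\<lambda>i. Re (L i)" Z] L by (meson not_le)
  have "((\<lambda>r. \<Sum>i<n. Re (g i (of_real r * \<zeta>))) \<longlongrightarrow> (\<Sum>i<n. Re (L i))) (at_left 1)"
    using lim unfolding has_radial_limit_def by (intro tendsto_sum tendsto_Re) auto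
  hence "\<forall>\<^sub>F r in at_left 1. Z < (\<Sum>i<n. Re (g i (of_real r * \<zeta>)))"
    using n by (rule order_tendstoD)
  with eventually_radius show "\<forall>\<^sub>F r in at_left 1. Z \<le> Re (\<Sum>i. g i (of_real r * \<zeta>))"
  proof eventually_elim
    case (elim r)
    have b: "of_real r * \<zeta> \<in> ball 0 1" using radial_in_ball z elim by blast
    have "(\<Sum>i<n. Re (g i (of_real r * \<zeta>))) \<le> (\<Sum>i. Re (g i (of_real r * \<zeta>)))"
      using sum[OF b] pos[OF b] by (intro sum_le_suminf summable_Re) auto
    also have "\<dots> = Re (\<Sum>i. g i (of_real r * \<zeta>))" by (rule bounded_linear.suminf[OF bounded_linear_Re sum[OF b], symmetric])
    finally show ?case using elim by simp
  qed
qed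

lemma radial_limit_inverse_at_top:
  assumes "filterlim (\<lambda>r. Re (h (of_real r * \<zeta>))) at_top (at_left 1)"
  shows "has_radial_limit (\<lambda>z. 1 / (1 + h z)) \<zeta> 0"
  unfolding has_radial_limit_def
proof (rule Lim_null_comparison)
  show "\<forall>\<^sub>F r in at_left 1. norm (1 / (1 + h (of_real r * \<zeta>))) \<le> inverse (Re (h (of_real r * \<zeta>)))"
    using assms[unfolded filterlim_at_top, rule_format, of 1]
  proof eventually_elim
    case (elim r)
    have "Re (h (of_real r * \<zeta>)) \<le> norm (1 + h (of_real r * \<zeta>))"
      using complex_Re_le_cmod[of "1 + h (of_real r * \<zeta>)"] by simp
    moreover have "norm (1 / (1 + h (of_real r * \<zeta>))) = inverse (norm (1 + h (of_real r * \<zeta>)))"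
      by (simp add: norm_divide inverse_eq_divide)
    ultimately show ?case using elim by (simp add: le_imp_inverse_le)
  qed
  show "((\<lambda>r. inverse (Re (h (of_real r * \<zeta>)))) \<longlongrightarrow> 0) (at_left 1)"
    by (rule filterlim_compose[OF tendsto_inverse_0_at_top[OF filterlim_ident] assms])
qed

subsection \<open>The theorem\<close>

text \<open>All discs used are centred at positive distance from \<open>K\<close>, which keeps each
  \<open>g i\<close> below \<open>\<eta> i\<close> on the radii to \<open>K\<close>; together they
  cover \<open>F\<close>, so at every point of \<open>F\<close> some \<open>g i\<close> has real
  part at least 1/5.\<close>

lemma separating_function:
  assumes K: "compact K" and F: "F \<subseteq> sphere 0 1" "F \<inter> K = {}" "negligible {t \<in> {0..2*pi}. cis t \<in> F}"
    and KT: "K \<subseteq> sphere 0 1" and \<epsilon>: "0 < \<epsilon>"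
  shows "\<exists>\<Phi>. \<Phi> holomorphic_on ball 0 1 \<and>
    (\<forall>z\<in>ball 0 1. norm (\<Phi> z) \<le> 1 \<and> 0 \<le> Re (\<Phi> z) \<and> (norm z \<le> 1 - \<epsilon> \<longrightarrow> norm (\<Phi> z) \<le> \<epsilon>)) \<and>
    (\<forall>\<zeta>\<in>K. \<forall>r\<in>{0..<1}. norm (\<Phi> (of_real r * \<zeta>)) \<le> \<epsilon>) \<and>
    (\<forall>\<zeta>\<in>sphere 0 1. \<exists>L. has_radial_limit \<Phi> \<zeta> L \<and> (\<zeta> \<in> F \<longrightarrow> 1/6 \<le> Re L))"
proof -
  \<comment> \<open>The index \<open>i\<close> encodes a pair: a slice \<open>Q (m i)\<close> of
    \<open>F\<close> and the number of a batch of discs covering that slice.\<close>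
  define m where "m i = fst (prod_decode i)" for i
  \<comment> \<open>The three entries serve, in order, the radii ending in \<open>K\<close>, the
    disc \<open>norm z \<le> 1 - \<epsilon>\<close>, and convergence on every smaller disc, for
    which \<open>d i\<close> must tend to 0.\<close>
  define d where "d i = min (1 / (2 * (real (m i) + 1))) (min \<epsilon> (1 / (real i + 1)))" for i
  define \<eta> where "\<eta> i = \<epsilon> * (1/2) ^ Suc i" for i
  \<comment> \<open>Since \<open>F\<close> may accumulate at \<open>K\<close>, it is exhausted by
    slices at positive distance from \<open>K\<close>.\<close>
  define Q where "Q n = {\<zeta>\<in>F. \<forall>k\<in>K. 1 / (real n + 1) \<le> norm (\<zeta> - k)}" for n
  have d0: "0 < d i" and \<eta>0: "0 < \<eta> i" for i using \<epsilon> by (simp_all add: d_def \<eta>_def)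
  have \<eta>: "\<eta> sums \<epsilon>" unfolding \<eta>_def using sums_mult[OF power_half_series, of \<epsilon>] by simp
  \<comment> \<open>The iteration depth equals the index, which makes the errors
    \<open>\<eta> i + 1 / 2 ^ i\<close> summable.\<close>
  have "\<forall>i. \<exists>B>0. \<forall>P. arcs P \<longrightarrow> sum snd P \<le> B \<longrightarrow> (\<exists>g. adapted P (d i) (\<eta> i) (\<eta> i + 1 / 2 ^ i) g)"
    using adapted_exists d0 \<eta>0 by blast
  then obtain B where B: "\<forall>i. 0 < B i"
    "\<forall>i P. arcs P \<longrightarrow> sum snd P \<le> B i \<longrightarrow> (\<exists>g. adapted P (d i) (\<eta> i) (\<eta> i + 1 / 2 ^ i) g)"
    by metis
  have ex: "\<exists>P :: nat \<Rightarrow> (complex \<times> real) set.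
     (\<forall>l. arcs (P l) \<and> fst ` P l \<subseteq> Q n \<and> sum snd (P l) \<le> B (prod_encode (n, l))) \<and>
     Q n \<subseteq> (\<Union>l. \<Union>p\<in>P l. ball (fst p) (snd p))" for n
  proof (rule null_set_arcs)
    show "Q n \<subseteq> sphere 0 1" using F by (auto simp: Q_def)
    show "negligible {t \<in> {0..2*pi}. cis t \<in> Q n}"
      by (rule negligible_subset[OF F(3)]) (auto simp: Q_def)
    show "0 < B (prod_encode (n, l))" for l using B(1) by simp
  qed
  have "\<exists>P :: nat \<Rightarrow> nat \<Rightarrow> (complex \<times> real) set. \<forall>n.
     (\<forall>l. arcs (P n l) \<and> fst ` P n l \<subseteq> Q n \<and> sum snd (P n l) \<le> B (prod_encode (n, l))) \<and>
     Q n \<subseteq> (\<Union>l. \<Union>p\<in>P n l. ball (fst p) (snd p))"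
    by (rule choice, rule allI, rule ex)
  then obtain P :: "nat \<Rightarrow> nat \<Rightarrow> (complex \<times> real) set" where
    P: "\<forall>n. Q n \<subseteq> (\<Union>l. \<Union>p\<in>P n l. ball (fst p) (snd p))"
    and P': "\<forall>n l. arcs (P n l)" "\<forall>n l. fst ` P n l \<subseteq> Q n" "\<forall>n l. sum snd (P n l) \<le> B (prod_encode (n, l))"
    unfolding all_conj_distrib by (elim exE conjE)
  define R where "R i = P (m i) (snd (prod_decode i))" for i
  have R: "arcs (R i)" "fst ` R i \<subseteq> Q (m i)" "sum snd (R i) \<le> B i" for i
    using P'[rule_format, of "m i" "snd (prod_decode i)"] by (simp_all add: R_def m_def)
  have "\<forall>i. \<exists>g. adapted (R i) (d i) (\<eta> i) (\<eta> i + 1 / 2 ^ i) g" using B(2) R by blast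
  then obtain g where g: "\<forall>i. adapted (R i) (d i) (\<eta> i) (\<eta> i + 1 / 2 ^ i) (g i)" by metis
  have hol: "g i holomorphic_on ball 0 1" and cont: "continuous_on (cball 0 1) (g i)" for i
    using g unfolding adapted_def by blast+
  have Re0: "0 \<le> Re (g i z)" if "z \<in> cball 0 1" for i z using g that unfolding adapted_def by blast
  have cover: "\<exists>i. 1/5 \<le> Re (g i \<zeta>)" if z: "\<zeta> \<in> F" for \<zeta>
  proof -
    have "closed K" "\<zeta> \<notin> K" using K F z by (auto intro: compact_imp_closed)
    then obtain e where e: "0 < e" "\<forall>k\<in>K. e \<le> dist \<zeta> k" using separate_point_closed by blast
    obtain n where "1 / (real n + 1) < e" using nat_approx_posE[OF e(1)] by (auto simp: add.commute)
    hence "\<zeta> \<in> Q n" using e z unfolding Q_def by (force simp: dist_norm)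
    then obtain l p where l: "p \<in> P n l" "\<zeta> \<in> ball (fst p) (snd p)" using P by blast
    hence "p \<in> R (prod_encode (n, l))" by (simp add: R_def m_def)
    moreover have "\<zeta> \<in> sphere 0 1" using z F by blast
    ultimately show ?thesis using g l(2) unfolding adapted_def by blast
  qed
  have far: "norm (g i z) \<le> \<eta> i" if "z \<in> ball 0 1" "\<And>p. p \<in> R i \<Longrightarrow> d i \<le> norm (z - fst p)" for i z
  proof -
    have "z \<in> cball 0 1" using that(1) by simp
    thus ?thesis using g that(2) unfolding adapted_def by blast
  qed
  have R1: "norm (fst p) = 1" if "p \<in> R i" for p i using R(1)[of i] that unfolding arcs_def by blast
  have inner: "norm (g i z) \<le> \<eta> i" if "z \<in> ball 0 1" "d i \<le> 1 - norm z" for i z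
  proof (rule far[OF that(1)])
    fix p assume "p \<in> R i"
    hence "norm (fst p) = 1" by (rule R1)
    thus "d i \<le> norm (z - fst p)" using that(2) norm_triangle_ineq2[of "fst p" z] by (simp add: norm_minus_commute)
  qed
  define H where "H z = (\<Sum>i. g i z)" for z
  have bound: "\<forall>\<^sub>F i in sequentially. \<forall>z\<in>cball 0 s. norm (g i z) \<le> \<eta> i" if s: "s < 1" for s :: real
  proof -
    obtain N where N: "1 / (real N + 1) < 1 - s" using nat_approx_posE[of "1 - s"] s by (auto simp: add.commute)
    show ?thesis
    proof (intro eventually_sequentiallyI[of N] ballI)
      fix i and z :: complex assume i: "N \<le> i" and z: "z \<in> cball 0 s"
      have "d i \<le> 1 / (real i + 1)" by (simp add: d_def)
      also have "\<dots> \<le> 1 / (real N + 1)" using i by (intro divide_left_mono) auto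
      finally show "norm (g i z) \<le> \<eta> i" using N s z by (intro inner) auto
    qed
  qed
  have sum\<eta>: "summable \<eta>" using \<eta> by (rule sums_summable)
  have holH: "H holomorphic_on ball 0 1"
    unfolding H_def by (rule holomorphic_suminf_disc[OF hol sum\<eta> bound])
  have sumg: "summable (\<lambda>i. g i z)" if "z \<in> ball 0 1" for z
    by (rule summable_disc[OF hol sum\<eta> bound that])
  have Hle: "norm (H z) \<le> \<epsilon>" if "\<And>i. norm (g i z) \<le> \<eta> i" for z
    unfolding H_def using norm_suminf_le[OF that sum\<eta>] sums_unique[OF \<eta>] by simp
  have ReH: "0 \<le> Re (H z)" if z: "z \<in> ball 0 1" for z
    unfolding H_def bounded_linear.suminf[OF bounded_linear_Re sumg[OF z]]
    using z by (intro suminf_nonneg summable_Re sumg Re0) auto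
  define \<Phi> where "\<Phi> z = H z / (1 + H z)" for z
  have le: "norm (\<Phi> z) \<le> norm (H z)" if "z \<in> ball 0 1" for z
    unfolding \<Phi>_def by (rule cayley_half_plane(3)[OF ReH[OF that]])
  have nz: "1 + H z \<noteq> 0" if "z \<in> ball 0 1" for z by (rule cayley_half_plane(1)[OF ReH[OF that]])
  show ?thesis
  proof (intro exI[of _ \<Phi>] conjI ballI impI)
    show "\<Phi> holomorphic_on ball 0 1" unfolding \<Phi>_def using holH nz by (intro holomorphic_intros) auto
  next
    fix z :: complex assume z: "z \<in> ball 0 1"
    show "norm (\<Phi> z) \<le> 1" "0 \<le> Re (\<Phi> z)" unfolding \<Phi>_def
      by (rule cayley_half_plane(2)[OF ReH[OF z]], rule cayley_half_plane(5)[OF ReH[OF z]])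
    assume "norm z \<le> 1 - \<epsilon>"
    hence "d i \<le> 1 - norm z" for i by (simp add: d_def)
    hence "norm (H z) \<le> \<epsilon>" by (intro Hle inner z)
    thus "norm (\<Phi> z) \<le> \<epsilon>" using le[OF z] by simp
  next
    fix \<zeta> r assume z: "\<zeta> \<in> K" "r \<in> {0..<1::real}"
    have z1: "norm \<zeta> = 1" using z KT by auto
    have b: "of_real r * \<zeta> \<in> ball 0 1" using z z1 by (simp add: norm_mult)
    have "norm (H (of_real r * \<zeta>)) \<le> \<epsilon>"
    proof (intro Hle far[OF b])
      fix i p assume p: "p \<in> R i"
      have "fst p \<in> Q (m i)" using p R(2) by blast
      hence "1 / (real (m i) + 1) \<le> norm (\<zeta> - fst p)" using z(1) by (auto simp: Q_def norm_minus_commute)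
      also have "\<dots> \<le> 2 * norm (of_real r * \<zeta> - fst p)"
        using norm_radial_diff_ge[OF z1 R1[OF p], of r] z(2) by simp
      finally have "1 / (2 * (real (m i) + 1)) \<le> norm (of_real r * \<zeta> - fst p)" by (simp add: field_simps)
      thus "d i \<le> norm (of_real r * \<zeta> - fst p)" by (simp add: d_def)
    qed
    thus "norm (\<Phi> (of_real r * \<zeta>)) \<le> \<epsilon>" using le[OF b] by simp
  next
    fix \<zeta> :: complex assume z: "\<zeta> \<in> sphere 0 1"
    hence zc: "\<zeta> \<in> cball 0 1" by simp
    have lim: "has_radial_limit (g i) \<zeta> (g i \<zeta>)" for i by (rule has_radial_limit_continuous[OF cont z])
    show "\<exists>L. has_radial_limit \<Phi> \<zeta> L \<and> (\<zeta> \<in> F \<longrightarrow> 1/6 \<le> Re L)"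
    proof (cases "summable (\<lambda>i. Re (g i \<zeta>))")
      case True
      define M where "M i = 20 * Re (g i \<zeta>) + (\<eta> i + (1/2) ^ i)" for i
      have M: "summable M" unfolding M_def
        by (intro summable_add summable_mult True sum\<eta> summable_geometric) simp
      have bd: "\<forall>\<^sub>F i in sequentially. \<forall>r\<in>{0..<1}. norm (g i (of_real r * \<zeta>)) \<le> M i"
      proof (intro always_eventually allI ballI)
        fix i r assume "r \<in> {0..<1::real}"
        hence "norm (g i (of_real r * \<zeta>)) \<le> 20 * Re (g i \<zeta>) + (\<eta> i + 1 / 2 ^ i)"
          using g z unfolding adapted_def by (meson atLeastAtMost_iff atLeastLessThan_iff less_imp_le)
        thus "norm (g i (of_real r * \<zeta>)) \<le> M i" by (simp add: M_def power_one_over)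
      qed
      have L: "summable (\<lambda>i. g i \<zeta>)" "has_radial_limit H \<zeta> (\<Sum>i. g i \<zeta>)"
        unfolding H_def by (rule radial_limit_suminf[OF lim M bd])+
      define L where "L = (\<Sum>i. g i \<zeta>)"
      have ReL: "Re L = (\<Sum>i. Re (g i \<zeta>))"
        unfolding L_def by (rule bounded_linear.suminf[OF bounded_linear_Re L(1)])
      have L0: "0 \<le> Re L" unfolding ReL by (intro suminf_nonneg True Re0 zc)
      have "has_radial_limit \<Phi> \<zeta> (L / (1 + L))"
        using L(2) cayley_half_plane(1)[OF L0] unfolding has_radial_limit_def \<Phi>_def L_def
        by (intro tendsto_intros) auto
      \<comment> \<open>The 1/6 is the value of \<open>x / (1 + x)\<close> at 1/5.\<close>
      moreover have "1/6 \<le> Re (L / (1 + L))" if zF: "\<zeta> \<in> F"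
      proof -
        obtain i where i: "1/5 \<le> Re (g i \<zeta>)" using cover[OF zF] by blast
        have "Re (g i \<zeta>) \<le> Re L"
          unfolding ReL using sum_le_suminf[OF True, of "{i}"] Re0[OF zc] by simp
        hence "1/6 \<le> Re L / (1 + Re L)" using i by (simp add: field_simps)
        thus ?thesis using cayley_half_plane(4)[OF L0] by linarith
      qed
      ultimately show ?thesis by blast
    next
      case False
      have "filterlim (\<lambda>r. Re (H (of_real r * \<zeta>))) at_top (at_left 1)"
        unfolding H_def
        by (rule radial_divergence_suminf[OF z lim _ sumg _ False]) (auto intro: Re0 zc)
      hence "has_radial_limit (\<lambda>z. 1 / (1 + H z)) \<zeta> 0" by (rule radial_limit_inverse_at_top)
      hence *: "((\<lambda>r. 1 - 1 / (1 + H (of_real r * \<zeta>))) \<longlongrightarrow> 1 - 0) (at_left 1)"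
        unfolding has_radial_limit_def by (intro tendsto_intros)
      have "\<forall>\<^sub>F r in at_left 1. 1 - 1 / (1 + H (of_real r * \<zeta>)) = \<Phi> (of_real r * \<zeta>)"
        using eventually_radius
      proof eventually_elim
        case (elim r)
        have "1 + H (of_real r * \<zeta>) \<noteq> 0" by (rule nz[OF radial_in_ball[OF z elim]])
        thus ?case by (simp add: \<Phi>_def field_simps)
      qed
      hence "has_radial_limit \<Phi> \<zeta> 1"
        unfolding has_radial_limit_def using Lim_transform_eventually[OF *] by simp
      thus ?thesis by (intro exI[of _ 1]) simp
    qed
  qed
qed

theorem theorem1:
  fixes F :: "complex set"
  assumes "gdelta_in (top_of_set (sphere 0 1)) F"
    and "circle_null F"
  shows "\<exists>f \<in> H_infty.
           (\<forall>z \<in> ball 0 1. Re (f z) > 0) \<and>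
           (\<forall>\<zeta> \<in> sphere 0 1. fatou_point f \<zeta>) \<and>
           (\<forall>\<zeta> \<in> sphere 0 1. has_radial_limit f \<zeta> 0 \<longleftrightarrow> \<zeta> \<in> F)"
proof -
  obtain C where C: "\<forall>n. openin (top_of_set (sphere (0::complex) 1)) (C n)" "\<forall>n. C (Suc n) \<subseteq> C n" "\<Inter>(range C) = F"
    using assms(1) unfolding gdelta_in_descending by blast
  define K where "K n = sphere 0 1 - C n" for n
  have FT: "F \<subseteq> sphere 0 1" using gdelta_in_subset[OF assms(1)] by simp
  have K: "compact (K n)" "K n \<subseteq> sphere 0 1" "F \<inter> K n = {}" for n
  proof -
    have "closedin (top_of_set (sphere 0 1)) (topspace (top_of_set (sphere 0 1)) - C n)"
      using C(1) by (intro closedin_diff closedin_topspace) blast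
    hence "closedin (top_of_set (sphere 0 1)) (K n)" by (simp add: K_def)
    thus "compact (K n)" by (rule closedin_compact[rotated]) simp
    show "K n \<subseteq> sphere 0 1" "F \<inter> K n = {}" using C(3) by (auto simp: K_def)
  qed
  \<comment> \<open>Because the \<open>C n\<close> decrease, a point that leaves one of them stays
    outside all later ones; hence all but finitely many \<open>\<Phi> n\<close> are small on its
    radius.\<close>
  have Kev: "\<forall>\<^sub>F n in sequentially. \<zeta> \<in> K n" if z: "\<zeta> \<in> sphere 0 1" "\<zeta> \<notin> F" for \<zeta>
  proof -
    obtain N where N: "\<zeta> \<notin> C N" using C(3) z(2) by blast
    have "C n \<subseteq> C N" if "N \<le> n" for n
      using lift_Suc_antimono_le[of C N n] C(2) that by blast
    thus ?thesis using N z(1) unfolding K_def by (intro eventually_sequentiallyI[of N]) blast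
  qed
  have null: "negligible {t \<in> {0..2*pi}. cis t \<in> F}"
    using assms(2) unfolding circle_null_def negligible_iff_null_sets
    by (auto intro: null_sets_completionI)
  \<comment> \<open>Summability makes \<open>\<epsilon>\<close> the majorant in the M-test, both on
    smaller discs and on radii ending off \<open>F\<close>.\<close>
  define \<epsilon> :: "nat \<Rightarrow> real" where "\<epsilon> n = (1/2) ^ Suc n" for n
  have \<epsilon>0: "0 < \<epsilon> n" for n by (simp add: \<epsilon>_def)
  have sum\<epsilon>: "summable \<epsilon>" unfolding \<epsilon>_def using power_half_series sums_summable by blast
  have "\<forall>n. \<exists>\<Phi>. \<Phi> holomorphic_on ball 0 1 \<and>
    (\<forall>z\<in>ball 0 1. norm (\<Phi> z) \<le> 1 \<and> 0 \<le> Re (\<Phi> z) \<and> (norm z \<le> 1 - \<epsilon> n \<longrightarrow> norm (\<Phi> z) \<le> \<epsilon> n)) \<and>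
    (\<forall>\<zeta>\<in>K n. \<forall>r\<in>{0..<1}. norm (\<Phi> (of_real r * \<zeta>)) \<le> \<epsilon> n) \<and>
    (\<forall>\<zeta>\<in>sphere 0 1. \<exists>L. has_radial_limit \<Phi> \<zeta> L \<and> (\<zeta> \<in> F \<longrightarrow> 1/6 \<le> Re L))"
    by (intro allI separating_function K FT null \<epsilon>0)
  then obtain \<Phi> where \<Phi>: "\<forall>n. \<Phi> n holomorphic_on ball 0 1 \<and>
    (\<forall>z\<in>ball 0 1. norm (\<Phi> n z) \<le> 1 \<and> 0 \<le> Re (\<Phi> n z) \<and> (norm z \<le> 1 - \<epsilon> n \<longrightarrow> norm (\<Phi> n z) \<le> \<epsilon> n)) \<and>
    (\<forall>\<zeta>\<in>K n. \<forall>r\<in>{0..<1}. norm (\<Phi> n (of_real r * \<zeta>)) \<le> \<epsilon> n) \<and>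
    (\<forall>\<zeta>\<in>sphere 0 1. \<exists>L. has_radial_limit (\<Phi> n) \<zeta> L \<and> (\<zeta> \<in> F \<longrightarrow> 1/6 \<le> Re L))"
    by (rule choice[THEN exE])
  have hol: "\<Phi> n holomorphic_on ball 0 1" for n using \<Phi> by blast
  have pos: "0 \<le> Re (\<Phi> n z)" if "z \<in> ball 0 1" for n z using \<Phi> that by blast
  have bound: "\<forall>\<^sub>F n in sequentially. \<forall>z\<in>cball 0 s. norm (\<Phi> n z) \<le> \<epsilon> n" if s: "s < 1" for s :: real
  proof -
    have "\<forall>\<^sub>F n in sequentially. \<epsilon> n < 1 - s"
      using s by (intro order_tendstoD(2)[OF summable_LIMSEQ_zero[OF sum\<epsilon>]]) simp
    thus ?thesis
    proof eventually_elim
      case (elim n)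
      show ?case
      proof
        fix z :: complex assume "z \<in> cball 0 s"
        hence "z \<in> ball 0 1" "norm z \<le> 1 - \<epsilon> n" using s elim by auto
        thus "norm (\<Phi> n z) \<le> \<epsilon> n" using \<Phi> by blast
      qed
    qed
  qed
  define h where "h z = (\<Sum>n. \<Phi> n z)" for z
  have holh: "h holomorphic_on ball 0 1"
    unfolding h_def by (rule holomorphic_suminf_disc[OF hol sum\<epsilon> bound])
  have sumh: "summable (\<lambda>n. \<Phi> n z)" if "z \<in> ball 0 1" for z
    by (rule summable_disc[OF hol sum\<epsilon> bound that])
  have Reh: "0 \<le> Re (h z)" if z: "z \<in> ball 0 1" for z
    unfolding h_def bounded_linear.suminf[OF bounded_linear_Re sumh[OF z]]
    using z by (intro suminf_nonneg summable_Re sumh pos)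
  define f where "f z = 1 / (1 + h z)" for z
  have nz: "1 + h z \<noteq> 0" if "z \<in> ball 0 1" for z by (rule cayley_half_plane(1)[OF Reh[OF that]])
  have lim_in: "has_radial_limit f \<zeta> 0" if z: "\<zeta> \<in> F" for \<zeta>
  proof -
    have zs: "\<zeta> \<in> sphere 0 1" using z FT by blast
    hence "\<forall>n. \<exists>L. has_radial_limit (\<Phi> n) \<zeta> L \<and> 1/6 \<le> Re L" using \<Phi> z by blast
    then obtain L where L: "\<forall>n. has_radial_limit (\<Phi> n) \<zeta> (L n) \<and> 1/6 \<le> Re (L n)" by metis
    have L0: "0 \<le> Re (L n)" for n using L[rule_format, of n] by linarith
    \<comment> \<open>Every term is at least 1/6, so the terms cannot tend to 0.\<close>
    have "\<not> summable (\<lambda>n. Re (L n))"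
    proof
      assume "summable (\<lambda>n. Re (L n))"
      hence "(\<lambda>n. Re (L n)) \<longlonglongrightarrow> 0" by (rule summable_LIMSEQ_zero)
      hence "1/6 \<le> (0::real)" by (rule LIMSEQ_le_const) (use L in blast)
      thus False by simp
    qed
    hence "filterlim (\<lambda>r. Re (h (of_real r * \<zeta>))) at_top (at_left 1)"
      unfolding h_def using L L0 by (intro radial_divergence_suminf[OF zs _ pos sumh]) auto
    thus ?thesis unfolding f_def by (rule radial_limit_inverse_at_top)
  qed
  have lim_out: "\<exists>L. L \<noteq> 0 \<and> has_radial_limit f \<zeta> L" if z: "\<zeta> \<in> sphere 0 1" "\<zeta> \<notin> F" for \<zeta>
  proof -
    have "\<forall>n. \<exists>L. has_radial_limit (\<Phi> n) \<zeta> L" using \<Phi> z by blast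
    then obtain L where L: "\<forall>n. has_radial_limit (\<Phi> n) \<zeta> (L n)" by metis
    have "\<forall>\<^sub>F n in sequentially. \<forall>r\<in>{0..<1}. norm (\<Phi> n (of_real r * \<zeta>)) \<le> \<epsilon> n"
      using Kev[OF z] by eventually_elim (use \<Phi> in blast)
    hence lim: "has_radial_limit h \<zeta> (\<Sum>n. L n)"
      unfolding h_def using L by (intro radial_limit_suminf(2)[OF _ sum\<epsilon>]) auto
    \<comment> \<open>A finite limit of \<open>h\<close> with nonnegative real part keeps
      \<open>1 + h\<close> away from 0 in the limit; the limit of \<open>f\<close> is then a nonzero
      reciprocal.\<close>
    have "0 \<le> Re (\<Sum>n. L n)"
    proof (rule tendsto_lowerbound)
      show "((\<lambda>r. Re (h (of_real r * \<zeta>))) \<longlongrightarrow> Re (\<Sum>n. L n)) (at_left 1)"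
        using lim unfolding has_radial_limit_def by (rule tendsto_Re)
      show "\<forall>\<^sub>F r in at_left 1. 0 \<le> Re (h (of_real r * \<zeta>))"
        using eventually_radius by eventually_elim (intro Reh radial_in_ball z)
    qed simp
    hence "1 + (\<Sum>n. L n) \<noteq> 0" by (rule cayley_half_plane(1))
    moreover from this lim have "has_radial_limit f \<zeta> (1 / (1 + (\<Sum>n. L n)))"
      unfolding has_radial_limit_def f_def by (intro tendsto_intros)
    ultimately show ?thesis by (intro exI[of _ "1 / (1 + (\<Sum>n. L n))"]) simp
  qed
  have unique: "L = L'" if "has_radial_limit f \<zeta> L" "has_radial_limit f \<zeta> L'" for \<zeta> L L'
    using that unfolding has_radial_limit_def by (rule tendsto_unique[rotated]) simp
  show ?thesis
  proof (intro bexI[of _ f] conjI ballI)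
    show "has_radial_limit f \<zeta> 0 \<longleftrightarrow> \<zeta> \<in> F" if "\<zeta> \<in> sphere 0 1" for \<zeta>
      using lim_in lim_out[OF that] unique by metis
    show "fatou_point f \<zeta>" if "\<zeta> \<in> sphere 0 1" for \<zeta>
      using lim_in lim_out[OF that] unfolding fatou_point_def by blast
  next
    fix z :: complex assume z: "z \<in> ball 0 1"
    have "0 < Re (1 + h z)" using Reh[OF z] by simp
    moreover have "0 < (norm (1 + h z))\<^sup>2" using nz[OF z] by simp
    ultimately show "0 < Re (f z)" unfolding f_def Re_divide cmod_power2 by simp
  next
    have "f holomorphic_on ball 0 1" unfolding f_def using holh nz by (intro holomorphic_intros) auto
    moreover have "norm (f z) \<le> 1" if "z \<in> ball 0 1" for z
    proof -
      have "1 \<le> norm (1 + h z)" using Reh[OF that] complex_Re_le_cmod[of "1 + h z"] by simp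
      thus ?thesis by (simp add: f_def norm_divide divide_le_eq)
    qed
    ultimately show "f \<in> H_infty" unfolding H_infty_def bounded_iff by blast
  qed
qed

end
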